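(* Let $m\ge 2$ be an integer, $M=(m+1)(m+2)/2$, and let $K>0$ be a constant such that the Lebesgue constants of the Padua points satisfy $\mathscr{L}_k\big(X^{\mathrm{Pad}}_{(k+1)(k+2)/2}\big)\le K(\ln k)^2$ for all integers $k\ge 2$. Let $\mathcal{T}_N$ be a triangulation of $\Omega=[-1,1]^2$ with maximum edge length $h_{\max}$. If for some $0<\alpha<1$ $$h_{\max}<\min\left\{\frac{\alpha}{2K(m\ln m)^2},\ \sqrt2\left(1-\cos\left(\frac{\pi}{m+1}\right)\right)\right\},$$ then the set of Padua triangles $\mathcal{T}_M^{\mathrm{Pad}}$ is unisolvent in $\mathbb{P}_m(\mathbb{R}^2)$, and the histopolation operator $\Pi_m^{\mathrm{Pad}}:C(\Omega)\to\mathbb{P}_m(\mathbb{R}^2)$ is well-defined.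
   Context: $\mathbb{P}_m(\mathbb{R}^2)$ is the space of real bivariate polynomials of total degree at most $m$; its dimension is $M=(m+1)(m+2)/2$. Triangulation: $\mathcal{T}_N=\{t_1,\dots,t_N\}$ is a finite ordered list of closed non-degenerate triangles with $\Omega=\bigcup_{i=1}^N t_i$ and $|t_i\cap t_j|=0$ (Lebesgue measure zero) for $i\ne j$; $h_{\max}$ is the maximum Euclidean length of an edge of a triangle of $\mathcal{T}_N$. Padua points: $$X_M^{\mathrm{Pad}}=\left\{\left((-1)^{i+j}\cos\frac{\pi j}{m+1},\,(-1)^{i+j}\cos\frac{i\pi}{m}\right): i,j\in\mathbb{Z}_{\ge 0},\ 0\le i+j\le m\right\}\subset[-1,1]^2 .$$ It is known that $X_M^{\mathrm{Pad}}$ has $M$ elements and is unisolvent for polynomial interpolation in $\mathbb{P}_m(\mathbb{R}^2)$. Its Lebesgue constant is $\mathscr{L}_m(X_M^{\mathrm{Pad}})=\sup_{\xi\in\Omega}\sum_{\boldsymbol x\in X_M^{\mathrm{Pad}}}|\ell_{\boldsymbol x}(\xi)|$, where $\ell_{\boldsymbol x}\in\mathbb{P}_m(\mathbb{R}^2)$ are the Lagrange polynomials with $\ell_{\boldsymbol x}(\boldsymbol y)=\delta_{\boldsymbol x,\boldsymbol y}$ for $\boldsymbol x,\boldsymbol y\in X_M^{\mathrm{Pad}}$. It is known (Bos, Caliari, De Marchi, Vianello, Xu) that a constant $K$ as in the claim exists. Padua triangles: each Padua point $\boldsymbol x$ is attributed to the first triangle in the ordered list $\mathcal{T}_N$ that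 contains it; $\mathcal{T}_M^{\mathrm{Pad}}$ is the set of triangles obtained in this way. Unisolvence and histopolation: for a triangle $t$ put $\mu_t(f)=\frac1{|t|}\int_t f(x,y)\,\mathrm{d}x\,\mathrm{d}y$. The set $\mathcal{T}_M^{\mathrm{Pad}}$ is unisolvent in $\mathbb{P}_m(\mathbb{R}^2)$ if it consists of exactly $M$ triangles and the only $p\in\mathbb{P}_m(\mathbb{R}^2)$ with $\mu_t(p)=0$ for all $t\in\mathcal{T}_M^{\mathrm{Pad}}$ is $p=0$. The histopolation operator $\Pi_m^{\mathrm{Pad}}$ maps $f\in C(\Omega)$ to the polynomial $p\in\mathbb{P}_m(\mathbb{R}^2)$ with $\mu_t(p)=\mu_t(f)$ for all $t\in\mathcal{T}_M^{\mathrm{Pad}}$; it is well-defined if this polynomial exists and is unique for every $f\in C(\Omega)$. *)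

theory Defs
  imports "HOL-Analysis.Analysis"
begin

text \<open>Bivariate polynomials are identified with the functions on the plane that they induce.\<close>

definition bivariate_polys :: "nat \<Rightarrow> (real \<times> real \<Rightarrow> real) set" where
  "bivariate_polys m =
     {p. \<exists>c :: nat \<Rightarrow> nat \<Rightarrow> real.
           p = (\<lambda>(x, y). \<Sum>(i, j) \<in> {(i, j). i + j \<le> m}. c i j * x ^ i * y ^ j)}"

abbreviation unit_square :: "(real \<times> real) set" where
  "unit_square \<equiv> {-1..1} \<times> {-1..1}"

text \<open>A closed non-degenerate triangle is a 2-simplex, and its edges are its faces of
  affine dimension 1. Since the triangles are non-degenerate and overlap in null sets only, a list
  satisfying the following predicate has no repetitions.\<close>

definition triangulates :: "(real \<times> real) set list \<Rightarrow> (real \<times> real) set \<Rightarrow> bool" where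
  "triangulates ts \<Omega> \<longleftrightarrow>
     (\<forall>t \<in> set ts. 2 simplex t) \<and>
     \<Omega> = \<Union> (set ts) \<and>
     (\<forall>i < length ts. \<forall>j < length ts. i \<noteq> j \<longrightarrow> emeasure lborel (ts ! i \<inter> ts ! j) = 0)"

definition max_edge_length :: "(real \<times> real) set list \<Rightarrow> real" where
  "max_edge_length ts = Max {dist a b | a b. \<exists>t \<in> set ts. closed_segment a b edge_of t}"

definition padua_points :: "nat \<Rightarrow> (real \<times> real) set" where
  "padua_points m =
     {((-1) ^ (i + j) * cos (pi * real j / real (m + 1)),
       (-1) ^ (i + j) * cos (real i * pi / real m)) | i j. i + j \<le> m}"

definition lagrange_poly ::
    "nat \<Rightarrow> (real \<times> real) set \<Rightarrow> real \<times> real \<Rightarrow> (real \<times> real \<Rightarrow> real)" where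
  "lagrange_poly m X x =
     (THE l. l \<in> bivariate_polys m \<and> (\<forall>y \<in> X. l y = (if y = x then 1 else 0)))"

definition lebesgue_constant ::
    "nat \<Rightarrow> (real \<times> real) set \<Rightarrow> (real \<times> real) set \<Rightarrow> real" where
  "lebesgue_constant m X \<Omega> = (SUP \<xi> \<in> \<Omega>. \<Sum>x \<in> X. \<bar>lagrange_poly m X x \<xi>\<bar>)"

definition first_triangle ::
    "(real \<times> real) set list \<Rightarrow> real \<times> real \<Rightarrow> (real \<times> real) set" where
  "first_triangle ts x = the (List.find (\<lambda>t. x \<in> t) ts)"

definition padua_triangles ::
    "nat \<Rightarrow> (real \<times> real) set list \<Rightarrow> (real \<times> real) set set" where
  "padua_triangles m ts = first_triangle ts ` padua_points m"

definition mean_value :: "(real \<times> real) set \<Rightarrow> (real \<times> real \<Rightarrow> real) \<Rightarrow> real" where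
  "mean_value t f = 1 / measure lborel t * (LINT z:t|lborel. f z)"

definition unisolvent :: "nat \<Rightarrow> (real \<times> real) set set \<Rightarrow> bool" where
  "unisolvent m T \<longleftrightarrow>
     finite T \<and> card T = (m + 1) * (m + 2) div 2 \<and>
     (\<forall>p \<in> bivariate_polys m. (\<forall>t \<in> T. mean_value t p = 0) \<longrightarrow> p = (\<lambda>_. 0))"

definition is_histopolant ::
    "nat \<Rightarrow> (real \<times> real) set set \<Rightarrow> (real \<times> real \<Rightarrow> real) \<Rightarrow> (real \<times> real \<Rightarrow> real) \<Rightarrow> bool" where
  "is_histopolant m T f p \<longleftrightarrow>
     p \<in> bivariate_polys m \<and> (\<forall>t \<in> T. mean_value t p = mean_value t f)"

definition histopolation_well_defined ::
    "nat \<Rightarrow> (real \<times> real) set set \<Rightarrow> (real \<times> real) set \<Rightarrow> bool" where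
  "histopolation_well_defined m T \<Omega> \<longleftrightarrow>
     (\<forall>f. continuous_on \<Omega> f \<longrightarrow> (\<exists>!p. is_histopolant m T f p))"

end

(*
A polynomial p with vanishing means over the Padua triangles attains a value of size at most
2 m^2 B h at every Padua point, where B is the maximum of |p| over the square and h the maximal
edge length: the oscillation of p over a triangle is bounded through Markov's inequality in each
coordinate. By the definition of the Lebesgue constant, B <= 2 m^2 B h K (ln m)^2 <= alpha B, hence
p = 0. The second bound on h keeps different Padua points in different triangles, so that the
histopolation problem is a square linear system and uniqueness implies existence.
*)
theory Submission
  imports Defs
begin

section \<open>Square linear systems\<close>

text \<open>The 2 in the oscillation bound is \<open>sqrt 2 * sqrt 2\<close>: one factor turns the
  sum of the coordinate differences into the Euclidean distance, the other is lost in Markov's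
  inequality, whose sharp constant is the squared degree. This slack permits a short route to
  Markov: Bernstein's inequality for \<open>p (cos \<theta>)\<close> and once more for its
  derivative. The Lebesgue constant is built from \<open>lagrange_poly\<close>, a definite
  description that says nothing until the Padua points are known to be unisolvent. Unisolvence is
  therefore proved as well, by restriction to the generating curve and a count of roots.\<close>

lemma homogeneous_system_nontrivial_solution:
  fixes A :: "'e \<Rightarrow> 'i \<Rightarrow> 'a::field"
  assumes "finite E" "finite I" "card E < card I"
  shows "\<exists>c. (\<exists>i\<in>I. c i \<noteq> 0) \<and> (\<forall>e\<in>E. (\<Sum>i\<in>I. A e i * c i) = 0)"
  using assms
proof (induction E arbitrary: I A rule: finite_induct)
  case empty
  then obtain i where "i \<in> I" by (metis card.empty card_gt_0_iff ex_in_conv)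
  then show ?case by (intro exI[of _ "\<lambda>_. 1"]) auto
next
  case (insert e E)
  show ?case
  proof (cases "\<forall>i\<in>I. A e i = 0")
    case True
    have "card E < card I" using insert by simp
    from insert.IH[OF \<open>finite I\<close> this, of A] True show ?thesis by auto
  next
    case False
    then obtain i0 where i0: "i0 \<in> I" "A e i0 \<noteq> 0" by blast
    \<comment> \<open>Gaussian elimination with pivot row \<open>e\<close>: \<open>A'\<close> is the
      system with the unknown \<open>i0\<close> cleared from the other rows. A solution on
      \<open>I - {i0}\<close> is completed by solving row \<open>e\<close> for
      \<open>i0\<close>.\<close>
    define A' where "A' = (\<lambda>e' i. A e' i - A e' i0 / A e i0 * A e i)"
    have "card E < card (I - {i0})" "finite (I - {i0})"
      using insert i0 by auto
    from insert.IH[OF this(2,1), of A'] obtain c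
      where c: "\<exists>i\<in>I - {i0}. c i \<noteq> 0"
        and c0: "\<And>e'. e' \<in> E \<Longrightarrow> (\<Sum>i\<in>I - {i0}. A' e' i * c i) = 0" by blast
    define s where "s = (\<Sum>i\<in>I - {i0}. A e i * c i)"
    define c' where "c' = c(i0 := - s / A e i0)"
    have sum': "(\<Sum>i\<in>I. A e' i * c' i) = (\<Sum>i\<in>I - {i0}. A e' i * c i) - A e' i0 * s / A e i0" for e'
      by (subst sum.remove[OF \<open>finite I\<close> i0(1)]) (auto simp: c'_def intro!: sum.cong)
    have "(\<Sum>i\<in>I. A e' i * c' i) = 0" if "e' \<in> insert e E" for e'
    proof (cases "e' = e")
      case True
      then show ?thesis using i0 by (simp add: sum' s_def)
    next
      case False
      then have "e' \<in> E" using that by simp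
      have "(\<Sum>i\<in>I - {i0}. A' e' i * c i) =
          (\<Sum>i\<in>I - {i0}. A e' i * c i) - A e' i0 / A e i0 * s"
        unfolding s_def sum_distrib_left sum_subtractf[symmetric] A'_def
        by (intro sum.cong) (auto simp: algebra_simps)
      then show ?thesis using c0[OF \<open>e' \<in> E\<close>] by (simp add: sum')
    qed
    moreover have "\<exists>i\<in>I. c' i \<noteq> 0" using c by (auto simp: c'_def)
    ultimately show ?thesis by blast
  qed
qed

text \<open>Homogenisation: \<open>- b\<close> becomes the column of one more unknown,
  \<open>None\<close>, and the system has more unknowns than equations. Injectivity forces
  \<open>c None \<noteq> 0\<close> in a nontrivial solution, and dividing by it solves the original
  system.\<close>

lemma square_system_solvable:
  fixes A :: "'e \<Rightarrow> 'i \<Rightarrow> 'a::field"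
  assumes "finite E" "finite I" "card E = card I"
    and inj: "\<And>c. (\<forall>e\<in>E. (\<Sum>i\<in>I. A e i * c i) = 0) \<Longrightarrow> \<forall>i\<in>I. c i = 0"
  shows "\<exists>c. \<forall>e\<in>E. (\<Sum>i\<in>I. A e i * c i) = b e"
proof -
  define A' where "A' = (\<lambda>e oi. case oi of None \<Rightarrow> - b e | Some i \<Rightarrow> A e i)"
  have "finite (insert None (Some ` I))" "card E < card (insert None (Some ` I))"
    using assms by (auto simp: card_image)
  from homogeneous_system_nontrivial_solution[OF \<open>finite E\<close> this, of A'] obtain c
    where c: "\<exists>i\<in>insert None (Some ` I). c i \<noteq> 0"
      and "\<And>e. e \<in> E \<Longrightarrow> (\<Sum>i\<in>insert None (Some ` I). A' e i * c i) = 0" by blast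
  moreover have "(\<Sum>i\<in>insert None (Some ` I). A' e i * c i) =
      (\<Sum>i\<in>I. A e i * c (Some i)) - b e * c None" for e
    using \<open>finite I\<close> by (simp add: sum.reindex A'_def)
  ultimately have eq: "(\<Sum>i\<in>I. A e i * c (Some i)) = b e * c None" if "e \<in> E" for e
    using that by (metis eq_iff_diff_eq_0)
  have "c None \<noteq> 0"
  proof
    assume "c None = 0"
    then have "\<forall>i\<in>I. c (Some i) = 0"
      using eq by (intro inj[of "\<lambda>i. c (Some i)"]) simp
    with c \<open>c None = 0\<close> show False by auto
  qed
  then have "(\<Sum>i\<in>I. A e i * (c (Some i) / c None)) = b e" if "e \<in> E" for e
    using eq[OF that] by (simp flip: sum_divide_distrib)
  then show ?thesis by (intro exI[of _ "\<lambda>i. c (Some i) / c None"] ballI)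
qed

section \<open>Inequalities of Bernstein and Markov\<close>

text \<open>Arbitrary complex coefficients are allowed, so that a factor \<open>cis \<theta>\<close>
  or \<open>cis (- \<theta>)\<close> only raises the degree by one; real functions enter through
  \<open>of_real\<close>.\<close>

definition trig_poly :: "nat \<Rightarrow> (real \<Rightarrow> complex) \<Rightarrow> bool" where
  "trig_poly n f \<longleftrightarrow>
     (\<exists>c. f = (\<lambda>\<theta>. \<Sum>j\<in>{- int n..int n}. c j * cis (of_int j * \<theta>)))"

text \<open>A geometric sum whose ratio \<open>\<omega>\<close> is a root of unity of order dividing
  \<open>2 * n\<close>. At \<open>q = 2n\<close> and \<open>q = -2n\<close> the ratio is 1 again,
  but the half-step offset of the nodes makes every term -1.\<close>

lemma sum_cis_odd_multiples:
  fixes n :: nat and q :: int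
  assumes "n > 0" and "\<bar>q\<bar> < 4 * int n"
  shows "(\<Sum>k<2 * n. cis (of_int q * ((2 * real k + 1) * pi / (2 * real n)))) =
    (if q = 0 then 2 * of_nat n else if \<bar>q\<bar> = 2 * int n then - 2 * of_nat n else 0)"
proof -
  define \<omega> where "\<omega> = cis (of_int q * pi / real n)"
  have "cis (of_int q * ((2 * real k + 1) * pi / (2 * real n))) =
      cis (of_int q * pi / (2 * real n)) * \<omega> ^ k" for k
    unfolding \<omega>_def Complex.DeMoivre cis_mult using \<open>n > 0\<close>
    by (intro arg_cong[of _ _ cis]) (simp add: field_simps)
  then have sum_eq: "(\<Sum>k<2 * n. cis (of_int q * ((2 * real k + 1) * pi / (2 * real n)))) =
      cis (of_int q * pi / (2 * real n)) * (\<Sum>k<2 * n. \<omega> ^ k)"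
    by (simp add: sum_distrib_left)
  consider "q = 0" | "q = 2 * int n" | "q = - 2 * int n" | "q \<noteq> 0" "\<bar>q\<bar> \<noteq> 2 * int n" by linarith
  then show ?thesis
  proof cases
    case 1
    then show ?thesis by simp
  next
    case 2
    then have "of_int q * pi / real n = 2 * pi" "of_int q * pi / (2 * real n) = pi"
      using \<open>n > 0\<close> by auto
    then show ?thesis using 2 \<open>n > 0\<close> unfolding sum_eq \<omega>_def by simp
  next
    case 3
    then have "of_int q * pi / real n = - (2 * pi)" "of_int q * pi / (2 * real n) = - pi"
      using \<open>n > 0\<close> by auto
    then show ?thesis using 3 \<open>n > 0\<close> unfolding sum_eq \<omega>_def
      by (simp add: complex_eq_iff)
  next
    case 4
    have "\<omega> ^ (2 * n) = cis (2 * pi * of_int q)"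
      unfolding \<omega>_def Complex.DeMoivre using \<open>n > 0\<close>
      by (intro arg_cong[of _ _ cis]) (simp add: field_simps)
    then have "\<omega> ^ (2 * n) = 1" by (simp add: cis_multiple_2pi)
    have "\<omega> \<noteq> 1"
    proof
      assume "\<omega> = 1"
      then have "cos (of_int q * pi / real n) = 1" by (simp add: \<omega>_def complex_eq_iff)
      then obtain j :: int where "of_int q * pi / real n = of_int j * (2 * pi)"
        using cos_one_2pi_int by (metis mult.commute mult.assoc)
      then have "real_of_int q = of_int (2 * j * int n)" using \<open>n > 0\<close> by (simp add: field_simps)
      then have q: "q = 2 * int n * j" by (metis mult.commute mult.assoc of_int_eq_iff)
      then have "2 * int n * \<bar>j\<bar> < 2 * int n * 2" using assms by (simp add: abs_mult)
      then have "\<bar>j\<bar> < 2" using \<open>n > 0\<close> by simp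
      then have "j = 0 \<or> \<bar>j\<bar> = 1" by linarith
      then show False using 4 q by (auto simp: abs_mult)
    qed
    then show ?thesis using 4 \<open>\<omega> ^ (2 * n) = 1\<close> unfolding sum_eq
      by (simp add: geometric_sum)
  qed
qed

text \<open>These are the triangular Fourier coefficients of the Fejer kernel, up to normalisation.
  For fixed \<open>r\<close> the partner \<open>s = r - d\<close> exists iff \<open>r\<close> lies
  in an interval of this length.\<close>

lemma sum_pairs_with_difference:
  fixes d :: int
  shows "(\<Sum>r<n. \<Sum>s<n. if int r - int s = d then 1 else 0) = max 0 (int n - \<bar>d\<bar>)"
proof -
  have "(\<Sum>s<n. if int r - int s = d then 1 else 0) =
      (if int r \<in> {max 0 d..<min (int n) (int n + d)} then 1 else (0::int))" if "r < n" for r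
  proof (cases "d \<le> int r \<and> int r < int n + d")
    case True
    then have "{s\<in>{..<n}. int r - int s = d} = {nat (int r - d)}" by auto
    then have "(\<Sum>s<n. if int r - int s = d then 1 else (0::int)) = 1"
      by (simp flip: sum.inter_filter)
    then show ?thesis using True that by auto
  next
    case False
    then have "(\<Sum>s<n. if int r - int s = d then 1 else (0::int)) = 0"
      by (intro sum.neutral) auto
    then show ?thesis using False by auto
  qed
  then have "(\<Sum>r<n. \<Sum>s<n. if int r - int s = d then 1 else 0) =
      (\<Sum>r<n. if int r \<in> {max 0 d..<min (int n) (int n + d)} then 1 else (0::int))"
    by (intro sum.cong) auto
  also have "\<dots> = (\<Sum>i\<in>{0..<int n}. if i \<in> {max 0 d..<min (int n) (int n + d)} then 1 else 0)"
    by (rule sum.reindex_bij_witness[of _ nat int]) auto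
  also have "\<dots> = int (card {max 0 d..<min (int n) (int n + d)})"
  proof -
    have "{0..<int n} \<inter> {max 0 d..<min (int n) (int n + d)} = {max 0 d..<min (int n) (int n + d)}"
      by auto
    then show ?thesis by (simp add: sum.If_cases Int_def[symmetric] del: atLeastLessThan_iff)
  qed
  also have "\<dots> = max 0 (int n - \<bar>d\<bar>)" by auto
  finally show ?thesis .
qed

text \<open>M. Riesz' interpolation formula expresses the derivative of a trigonometric polynomial of degree
  at most \<open>n\<close> by its values at \<open>2n\<close> shifted points. The weight \<open>(-1)^k / (4n sin\<^sup>2 (t/2))\<close> of the
  node \<open>t\<close> is written with the Fejer kernel instead of its closed form, so that only sums of roots of
  unity are needed.\<close>

definition riesz_node :: "nat \<Rightarrow> nat \<Rightarrow> real" where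
  "riesz_node n k = (2 * real k + 1) * pi / (2 * real n)"

definition riesz_weight :: "nat \<Rightarrow> nat \<Rightarrow> real" where
  "riesz_weight n k =
     (-1) ^ k / (2 * real n) * (cmod (\<Sum>r<n. cis (real r * riesz_node n k)))\<^sup>2"

lemma fejer_kernel_eq:
  "of_real ((cmod (\<Sum>r<n. cis (real r * t)))\<^sup>2) = (\<Sum>r<n. \<Sum>s<n. cis (of_int (int r - int s) * t))"
proof -
  have "cis (of_int (int r - int s) * t) = cis (real r * t) * cnj (cis (real s * t))" for r s
    by (simp add: cis_cnj cis_mult algebra_simps)
  then show ?thesis
    by (simp only: complex_norm_square sum_distrib_left sum_distrib_right cnj_sum) (rule sum.swap)
qed

text \<open>Sampling at the nodes repeats the triangular coefficients with period
  \<open>2 * n\<close> and alternating sign. For these \<open>q\<close> only the central copy and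
  its two neighbours can be nonzero.\<close>

lemma sum_fejer_cis:
  fixes n :: nat and j :: int
  assumes "n > 0" "\<bar>q\<bar> \<le> 2 * int n"
  shows "(\<Sum>k<2 * n. of_real ((cmod (\<Sum>r<n. cis (real r * riesz_node n k)))\<^sup>2)
            * cis (of_int q * riesz_node n k)) =
    2 * of_nat n * of_int (max 0 (int n - \<bar>q\<bar>) - max 0 (int n - \<bar>2 * int n - q\<bar>)
       - max 0 (int n - \<bar>2 * int n + q\<bar>))"
proof -
  have e: "(\<Sum>k<2 * n. cis (of_int (int r - int s + q) * riesz_node n k)) =
      2 * of_nat n * of_int ((if int r - int s = - q then 1 else 0)
        - (if int r - int s = 2 * int n - q then 1 else 0)
        - (if int r - int s = - (2 * int n) - q then 1 else 0))"
    if "r < n" "s < n" for r s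
    unfolding riesz_node_def
    using that assms by (subst sum_cis_odd_multiples) auto
  have "(\<Sum>k<2 * n. of_real ((cmod (\<Sum>r<n. cis (real r * riesz_node n k)))\<^sup>2)
            * cis (of_int q * riesz_node n k)) =
      (\<Sum>k<2 * n. \<Sum>r<n. \<Sum>s<n. cis (of_int (int r - int s + q) * riesz_node n k))"
    unfolding fejer_kernel_eq sum_distrib_right
    by (intro sum.cong refl) (simp add: cis_mult algebra_simps)
  also have "\<dots> = (\<Sum>r<n. \<Sum>k<2 * n. \<Sum>s<n. cis (of_int (int r - int s + q) * riesz_node n k))"
    by (rule sum.swap)
  also have "\<dots> = (\<Sum>r<n. \<Sum>s<n. \<Sum>k<2 * n. cis (of_int (int r - int s + q) * riesz_node n k))"
    by (rule sum.cong[OF refl], rule sum.swap)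
  also have "\<dots> = (\<Sum>r<n. \<Sum>s<n. 2 * of_nat n * of_int ((if int r - int s = - q then 1 else 0)
        - (if int r - int s = 2 * int n - q then 1 else 0)
        - (if int r - int s = - (2 * int n) - q then 1 else 0)))"
    by (intro sum.cong refl) (use e in auto)
  also have "\<dots> = 2 * of_nat n * of_int (\<Sum>r<n. \<Sum>s<n. (if int r - int s = - q then 1 else 0)
        - (if int r - int s = 2 * int n - q then 1 else 0)
        - (if int r - int s = - (2 * int n) - q then 1 else 0))"
    by (simp only: of_int_sum sum_distrib_left)
  also have "\<dots> = 2 * of_nat n * of_int (max 0 (int n - \<bar>q\<bar>) - max 0 (int n - \<bar>2 * int n - q\<bar>)
       - max 0 (int n - \<bar>2 * int n + q\<bar>))"
    unfolding sum_subtractf sum_pairs_with_difference by (simp add: abs_if)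
  finally show ?thesis .
qed

text \<open>Riesz' formula on a single exponential. At the nodes \<open>(-1) ^ k\<close> agrees with
  the exponential of frequency \<open>n\<close> up to the factor \<open>- \<i>\<close>, so the sum
  is a sampled Fejer coefficient at \<open>n + j\<close>.\<close>

lemma sum_riesz_weight_cis:
  assumes "n > 0" "\<bar>j\<bar> \<le> int n"
  shows "(\<Sum>k<2 * n. of_real (riesz_weight n k) * cis (of_int j * riesz_node n k)) = \<i> * of_int j"
proof -
  have sign: "complex_of_real ((-1) ^ k) = - \<i> * cis (of_int (int n) * riesz_node n k)" for k
  proof -
    have "real_of_int (int n) * riesz_node n k = real k * pi + pi / 2"
      using \<open>n > 0\<close> by (simp add: riesz_node_def field_simps)
    moreover have "cis (real k * pi) = (-1) ^ k" by (simp flip: Complex.DeMoivre)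
    ultimately show ?thesis by (simp add: mult.commute[of _ \<i>] flip: cis_mult)
  qed
  have "of_real (riesz_weight n k) * cis (of_int j * riesz_node n k) =
      - \<i> / (2 * of_nat n) * (of_real ((cmod (\<Sum>r<n. cis (real r * riesz_node n k)))\<^sup>2)
            * cis (of_int (int n + j) * riesz_node n k))" for k
    unfolding riesz_weight_def of_real_mult of_real_divide sign
    by (simp add: cis_mult[symmetric] ring_distribs)
  then have "(\<Sum>k<2 * n. of_real (riesz_weight n k) * cis (of_int j * riesz_node n k)) =
      - \<i> / (2 * of_nat n) * (\<Sum>k<2 * n. of_real ((cmod (\<Sum>r<n. cis (real r * riesz_node n k)))\<^sup>2)
            * cis (of_int (int n + j) * riesz_node n k))"
    by (simp only: sum_distrib_left)
  \<comment> \<open>At \<open>q = n + j\<close> the central copy contributes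
    \<open>max 0 (- j)\<close>, the copy around \<open>2 * n\<close> contributes
    \<open>- max 0 j\<close>, and the third one vanishes; together \<open>- j\<close>.\<close>
  also have "\<dots> = - \<i> / (2 * of_nat n) * (2 * of_nat n * of_int (- j))"
    using assms by (subst sum_fejer_cis) (auto simp: max_def)
  also have "\<dots> = \<i> * of_int j" using \<open>n > 0\<close> by simp
  finally show ?thesis .
qed

text \<open>Up to sign a weight is a nonnegative kernel value, so this is the sampled coefficient of
  frequency 0. The total \<open>n\<close> becomes the constant in Bernstein's inequality.\<close>

lemma sum_abs_riesz_weight:
  assumes "n > 0"
  shows "(\<Sum>k<2 * n. \<bar>riesz_weight n k\<bar>) = real n"
proof -
  have "complex_of_real (\<Sum>k<2 * n. \<bar>riesz_weight n k\<bar>) =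
      1 / (2 * of_nat n) * (\<Sum>k<2 * n. of_real ((cmod (\<Sum>r<n. cis (real r * riesz_node n k)))\<^sup>2)
            * cis (of_int 0 * riesz_node n k))"
    unfolding of_real_sum sum_distrib_left
    by (intro sum.cong refl) (simp add: riesz_weight_def abs_mult power_abs)
  also have "\<dots> = of_real (real n)"
    using assms by (subst sum_fejer_cis) auto
  finally show ?thesis by (simp only: of_real_eq_iff)
qed

lemma has_vector_derivative_cis_mult:
  "((\<lambda>\<theta>. cis (a * \<theta>)) has_vector_derivative \<i> * of_real a * cis (a * \<theta>)) (at \<theta>)"
proof -
  have "((\<lambda>\<theta>. exp (\<i> * of_real a * \<theta>)) has_field_derivative \<i> * of_real a * exp (\<i> * of_real a * of_real \<theta>))
      (at (of_real \<theta>))"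
    by (auto intro!: derivative_eq_intros)
  from has_vector_derivative_real_field[OF this] show ?thesis
    by (simp add: cis_conv_exp o_def mult_ac)
qed

lemma trig_poly_has_vector_derivative:
  "((\<lambda>\<theta>. \<Sum>j\<in>J. c j * cis (of_int j * \<theta>)) has_vector_derivative
     (\<Sum>j\<in>J. \<i> * of_int j * c j * cis (of_int j * \<theta>))) (at \<theta>)"
proof (intro has_vector_derivative_sum)
  fix j
  show "((\<lambda>\<theta>. c j * cis (of_int j * \<theta>)) has_vector_derivative \<i> * of_int j * c j * cis (of_int j * \<theta>)) (at \<theta>)"
    using has_vector_derivative_mult_right[OF has_vector_derivative_cis_mult[of "of_int j"], of "c j"]
    by (simp add: mult_ac)
qed

text \<open>By linearity Riesz' formula extends from exponentials to \<open>f\<close>: the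
  derivative is a combination of shifted values of \<open>f\<close> whose weights have absolute sum
  \<open>n\<close>. Degree 0 is separate because the nodes divide by \<open>n\<close>.\<close>

lemma bernstein_inequality:
  assumes "trig_poly n f" and "\<And>\<theta>. cmod (f \<theta>) \<le> B"
    and "(f has_vector_derivative D) (at \<theta>)"
  shows "cmod D \<le> real n * B"
proof -
  obtain c where f: "f = (\<lambda>\<theta>. \<Sum>j\<in>{- int n..int n}. c j * cis (of_int j * \<theta>))"
    using assms(1) by (auto simp: trig_poly_def)
  note trig_poly_has_vector_derivative[of c "{- int n..int n}" \<theta>, folded f]
  then have D: "D = (\<Sum>j\<in>{- int n..int n}. \<i> * of_int j * c j * cis (of_int j * \<theta>))"
    using assms(3) vector_derivative_unique_at by blast
  show ?thesis
  proof (cases "n = 0")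
    case True
    then show ?thesis by (simp add: D)
  next
    case False
    then have "n > 0" by simp
    have "D = (\<Sum>j\<in>{- int n..int n}. \<Sum>k<2 * n.
        of_real (riesz_weight n k) * (c j * cis (of_int j * (\<theta> + riesz_node n k))))"
      unfolding D
    proof (intro sum.cong refl)
      fix j assume "j \<in> {- int n..int n}"
      then have "\<i> * of_int j = (\<Sum>k<2 * n. of_real (riesz_weight n k) * cis (of_int j * riesz_node n k))"
        using sum_riesz_weight_cis[of n j] \<open>n > 0\<close> by auto
      then show "\<i> * of_int j * c j * cis (of_int j * \<theta>) = (\<Sum>k<2 * n.
        of_real (riesz_weight n k) * (c j * cis (of_int j * (\<theta> + riesz_node n k))))"
        by (simp add: sum_distrib_left sum_distrib_right ring_distribs cis_mult[symmetric] mult_ac)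
    qed
    also have "\<dots> = (\<Sum>k<2 * n. of_real (riesz_weight n k) * f (\<theta> + riesz_node n k))"
      unfolding f sum_distrib_left by (rule sum.swap)
    also have "cmod \<dots> \<le> (\<Sum>k<2 * n. \<bar>riesz_weight n k\<bar> * B)"
      by (intro sum_norm_le) (auto simp: norm_mult intro!: mult_left_mono assms(2))
    also have "\<dots> = real n * B"
      using sum_abs_riesz_weight[OF \<open>n > 0\<close>] by (simp flip: sum_distrib_right)
    finally show ?thesis .
  qed
qed

section \<open>Algebra of trigonometric polynomials and the substitution of the cosine\<close>

lemma trig_poly_Suc:
  assumes "trig_poly n f"
  shows "trig_poly (Suc n) f"
proof -
  obtain c where f: "f = (\<lambda>\<theta>. \<Sum>j\<in>{- int n..int n}. c j * cis (of_int j * \<theta>))"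
    using assms by (auto simp: trig_poly_def)
  show ?thesis
    unfolding trig_poly_def f
    by (intro exI[of _ "\<lambda>j. if j \<in> {- int n..int n} then c j else 0"] ext sum.mono_neutral_cong_left) auto
qed

lemma trig_poly_mono:
  assumes "trig_poly n f" "n \<le> n'"
  shows "trig_poly n' f"
  using assms(2,1) by (induction rule: dec_induct) (auto intro: trig_poly_Suc)

lemma trig_poly_add:
  assumes "trig_poly n f" "trig_poly n g"
  shows "trig_poly n (\<lambda>\<theta>. f \<theta> + g \<theta>)"
proof -
  obtain c d where "f = (\<lambda>\<theta>. \<Sum>j\<in>{- int n..int n}. c j * cis (of_int j * \<theta>))"
    "g = (\<lambda>\<theta>. \<Sum>j\<in>{- int n..int n}. d j * cis (of_int j * \<theta>))"
    using assms by (auto simp: trig_poly_def)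
  then show ?thesis unfolding trig_poly_def
    by (intro exI[of _ "\<lambda>j. c j + d j"]) (simp add: sum.distrib ring_distribs)
qed

lemma trig_poly_cmult:
  assumes "trig_poly n f"
  shows "trig_poly n (\<lambda>\<theta>. a * f \<theta>)"
proof -
  obtain c where "f = (\<lambda>\<theta>. \<Sum>j\<in>{- int n..int n}. c j * cis (of_int j * \<theta>))"
    using assms by (auto simp: trig_poly_def)
  then show ?thesis unfolding trig_poly_def
    by (intro exI[of _ "\<lambda>j. a * c j"]) (simp add: sum_distrib_left mult_ac)
qed

lemma trig_poly_const: "trig_poly n (\<lambda>_. a)"
proof -
  have "trig_poly 0 (\<lambda>_. a)"
    unfolding trig_poly_def by (intro exI[of _ "\<lambda>_. a"]) simp
  then show ?thesis by (rule trig_poly_mono) simp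
qed

lemma trig_poly_mult_cis:
  assumes "trig_poly n f" "\<bar>d\<bar> \<le> 1"
  shows "trig_poly (Suc n) (\<lambda>\<theta>. cis (of_int d * \<theta>) * f \<theta>)"
proof -
  obtain c where f: "f = (\<lambda>\<theta>. \<Sum>j\<in>{- int n..int n}. c j * cis (of_int j * \<theta>))"
    using assms by (auto simp: trig_poly_def)
  define c' where "c' = (\<lambda>j. if j - d \<in> {- int n..int n} then c (j - d) else 0)"
  have "cis (of_int d * \<theta>) * f \<theta> = (\<Sum>j\<in>{- int (Suc n)..int (Suc n)}. c' j * cis (of_int j * \<theta>))" for \<theta>
  proof -
    have "cis (of_int d * \<theta>) * f \<theta> = (\<Sum>j\<in>{- int n..int n}. c j * cis (of_int (j + d) * \<theta>))"
      by (simp add: f sum_distrib_left ring_distribs cis_mult[symmetric] mult_ac)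
    also have "\<dots> = (\<Sum>j\<in>{- int n + d..int n + d}. c' j * cis (of_int j * \<theta>))"
      by (rule sum.reindex_bij_witness[of _ "\<lambda>j. j - d" "\<lambda>j. j + d"]) (auto simp: c'_def)
    also have "\<dots> = (\<Sum>j\<in>{- int (Suc n)..int (Suc n)}. c' j * cis (of_int j * \<theta>))"
      using assms(2) by (intro sum.mono_neutral_left) (auto simp: c'_def)
    finally show ?thesis .
  qed
  then show ?thesis unfolding trig_poly_def by blast
qed

lemma trig_poly_mult_cos:
  assumes "trig_poly n f"
  shows "trig_poly (Suc n) (\<lambda>\<theta>. of_real (cos \<theta>) * f \<theta>)"
proof -
  have "of_real (cos \<theta>) = (cis (of_int 1 * \<theta>) + cis (of_int (-1) * \<theta>)) / 2" for \<theta>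
    by (simp add: complex_eq_iff)
  then have "(\<lambda>\<theta>. of_real (cos \<theta>) * f \<theta>) =
      (\<lambda>\<theta>. 1 / 2 * (cis (of_int 1 * \<theta>) * f \<theta> + cis (of_int (-1) * \<theta>) * f \<theta>))"
    by (auto simp: fun_eq_iff field_simps)
  moreover have "trig_poly (Suc n) \<dots>"
    by (intro trig_poly_cmult trig_poly_add trig_poly_mult_cis[OF assms]) auto
  ultimately show ?thesis by simp
qed

text \<open>Horner's scheme: each \<open>pCons\<close> is one multiplication by the cosine and the
  addition of a constant.\<close>

lemma trig_poly_poly_cos:
  fixes p :: "real poly"
  assumes "degree p \<le> n"
  shows "trig_poly n (\<lambda>\<theta>. of_real (poly p (cos \<theta>)))"
  using assms
proof (induction p arbitrary: n rule: pCons_induct)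
  case 0
  then show ?case by (simp add: trig_poly_const)
next
  case (pCons a p)
  show ?case
  proof (cases "p = 0")
    case True
    then show ?thesis by (simp add: trig_poly_const)
  next
    case False
    then obtain k where k: "n = Suc k" "degree p \<le> k"
      using pCons.prems by (cases n) (auto simp: degree_pCons_eq_if)
    show ?thesis unfolding k
      using trig_poly_add[OF trig_poly_const[of "Suc k" "of_real a"] trig_poly_mult_cos[OF pCons.IH[OF k(2)]]]
      by simp
  qed
qed

text \<open>This makes a second application of Bernstein's inequality possible, with the same
  degree.\<close>

lemma trig_poly_has_trig_poly_derivative:
  assumes "trig_poly n f"
  shows "\<exists>f'. trig_poly n f' \<and> (\<forall>\<theta>. (f has_vector_derivative f' \<theta>) (at \<theta>))"
proof -
  obtain c where f: "f = (\<lambda>\<theta>. \<Sum>j\<in>{- int n..int n}. c j * cis (of_int j * \<theta>))"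
    using assms by (auto simp: trig_poly_def)
  show ?thesis
    unfolding f trig_poly_def
    by (intro exI conjI allI) (rule refl, rule trig_poly_has_vector_derivative)
qed

section \<open>Markov's inequality up to a constant\<close>

lemma sin_ge_div_sqrt2:
  fixes x :: real
  assumes "0 \<le> x" "x \<le> pi / 4"
  shows "x \<le> sqrt 2 * sin x"
proof -
  \<comment> \<open>\<open>sin u - u * cos u\<close> vanishes at 0 and has the nonnegative
    derivative \<open>u * sin u\<close>. The cosine is then at least \<open>sqrt 2 / 2\<close> on
    the given range.\<close>
  have "x * cos x \<le> sin x"
  proof -
    have "((\<lambda>u. sin u - u * cos u) has_real_derivative u * sin u) (at u)" for u :: real
      by (auto intro!: derivative_eq_intros)
    moreover have "0 \<le> u * sin u" if "0 \<le> u" "u \<le> x" for u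
      using that assms by (intro mult_nonneg_nonneg sin_ge_zero) auto
    ultimately have "sin 0 - 0 * cos 0 \<le> sin x - x * cos x"
      using assms by (intro DERIV_nonneg_imp_nondecreasing[where f = "\<lambda>u. sin u - u * cos u"]) blast+
    then show ?thesis by simp
  qed
  moreover have "sqrt 2 / 2 \<le> cos x"
    using cos_monotone_0_pi_le[of x "pi / 4"] assms by (simp add: cos_45)
  then have "x * (sqrt 2 / 2) \<le> x * cos x" using assms by (intro mult_left_mono)
  ultimately have "sqrt 2 * (x * (sqrt 2 / 2)) \<le> sqrt 2 * sin x"
    by (intro mult_left_mono) auto
  then show ?thesis by (simp add: algebra_simps)
qed

lemma sin_ge_sqrt2_div_2:
  fixes x :: real
  assumes "pi / 4 \<le> x" "x \<le> 3 * pi / 4"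
  shows "1 \<le> sqrt 2 * sin x"
proof -
  have "cos (pi / 4) \<le> cos \<bar>x - pi / 2\<bar>"
    using assms by (intro cos_monotone_0_pi_le) (auto simp: abs_if)
  also have "\<dots> = sin x" by (simp add: cos_diff)
  finally have "sqrt 2 / 2 \<le> sin x" by (simp add: cos_45)
  then have "sqrt 2 * (sqrt 2 / 2) \<le> sqrt 2 * sin x" by (intro mult_left_mono) auto
  then show ?thesis by simp
qed

text \<open>With \<open>r \<theta>\<close> the derivative of \<open>p (cos \<theta>)\<close>, Bernstein's inequality bounds \<open>r\<close> by \<open>nB\<close> and its
  derivative by \<open>n\<^sup>2B\<close>. The first bound controls \<open>p' (cos \<theta>) = - r \<theta> / sin \<theta>\<close> in the middle of the
  interval, the second one near the ends, where \<open>r\<close> vanishes. The constant \<open>sqrt 2\<close> is not sharp.\<close>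

lemma markov_inequality_interior:
  fixes p :: "real poly"
  assumes "degree p \<le> n" and B: "\<And>x. \<bar>x\<bar> \<le> 1 \<Longrightarrow> \<bar>poly p x\<bar> \<le> B"
    and "-1 < x" "x < 1"
  shows "\<bar>poly (pderiv p) x\<bar> \<le> sqrt 2 * real n ^ 2 * B"
proof -
  define q where "q = (\<lambda>\<theta>. complex_of_real (poly p (cos \<theta>)))"
  define r where "r = (\<lambda>\<theta>. - sin \<theta> * poly (pderiv p) (cos \<theta>))"
  have "B \<ge> 0" using B[of 0] by simp
  have q: "trig_poly n q" unfolding q_def using assms(1) by (rule trig_poly_poly_cos)
  have qB: "cmod (q \<theta>) \<le> B" for \<theta> unfolding q_def by (simp add: B)
  have "((\<lambda>\<theta>. poly p (cos \<theta>)) has_real_derivative r \<theta>) (at \<theta>)" for \<theta>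
    unfolding r_def by (auto intro!: derivative_eq_intros poly_DERIV[THEN DERIV_chain2])
  then have q': "(q has_vector_derivative of_real (r \<theta>)) (at \<theta>)" for \<theta>
    unfolding q_def by (simp add: has_vector_derivative_of_real has_real_derivative_iff_has_vector_derivative)
  have r_le: "\<bar>r \<theta>\<bar> \<le> real n * B" for \<theta>
    using bernstein_inequality[OF q qB q'] by simp
  \<comment> \<open>\<open>r\<close> is itself a trigonometric polynomial of degree
    \<open>n\<close>: the derivative of \<open>q\<close> is one, and derivatives are unique.\<close>
  obtain f' where f': "trig_poly n f'" "\<And>\<theta>. (q has_vector_derivative f' \<theta>) (at \<theta>)"
    using trig_poly_has_trig_poly_derivative[OF q] by blast
  have "f' = (\<lambda>\<theta>. of_real (r \<theta>))"
    using vector_derivative_unique_at[OF f'(2) q'] by blast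
  with f' have r: "trig_poly n (\<lambda>\<theta>. of_real (r \<theta>))" by simp
  obtain r' where r': "\<And>\<theta>. (r has_real_derivative r' \<theta>) (at \<theta>)"
  proof
    show "(r has_real_derivative (- cos \<theta> * poly (pderiv p) (cos \<theta>)
       + sin \<theta> * (poly (pderiv (pderiv p)) (cos \<theta>) * sin \<theta>))) (at \<theta>)" for \<theta>
      unfolding r_def
      by (auto intro!: derivative_eq_intros poly_DERIV[THEN DERIV_chain2])
  qed
  have r'_le: "\<bar>r' \<theta>\<bar> \<le> real n ^ 2 * B" for \<theta>
  proof -
    have "((\<lambda>\<theta>. complex_of_real (r \<theta>)) has_vector_derivative of_real (r' \<theta>)) (at \<theta>)"
      using r' by (simp add: has_vector_derivative_of_real has_real_derivative_iff_has_vector_derivative)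
    from bernstein_inequality[OF r _ this, of "real n * B"] have "\<bar>r' \<theta>\<bar> \<le> real n * (real n * B)"
      using r_le by simp
    then show ?thesis by (simp add: power2_eq_square mult_ac)
  qed
  have lip: "\<bar>r u - r v\<bar> \<le> real n ^ 2 * B * \<bar>u - v\<bar>" for u v
    using field_differentiable_bound[of UNIV r r' "real n ^ 2 * B" u v] r' r'_le
    by (auto simp: field_differentiable_def)
  define \<theta> where "\<theta> = arccos x"
  have \<theta>: "cos \<theta> = x" "0 < \<theta>" "\<theta> < pi"
    using assms by (auto simp: \<theta>_def cos_arccos arccos_lt_bounded)
  then have "sin \<theta> > 0" by (intro sin_gt_zero)
  have "\<bar>r \<theta>\<bar> \<le> sqrt 2 * real n ^ 2 * B * sin \<theta>"
  proof -
    consider "\<theta> \<le> pi / 4" | "pi / 4 \<le> \<theta>" "\<theta> \<le> 3 * pi / 4" | "3 * pi / 4 \<le> \<theta>" by linarith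
    then show ?thesis
    proof cases
      case 1
      have "\<bar>r \<theta>\<bar> \<le> real n ^ 2 * B * \<theta>" using lip[of \<theta> 0] \<theta> by (simp add: r_def)
      also have "\<dots> \<le> real n ^ 2 * B * (sqrt 2 * sin \<theta>)"
        using 1 \<theta> \<open>B \<ge> 0\<close> by (intro mult_left_mono sin_ge_div_sqrt2) auto
      finally show ?thesis by (simp add: mult_ac)
    next
      case 2
      have "\<bar>r \<theta>\<bar> \<le> real n * B" by (rule r_le)
      also have "\<dots> \<le> real n ^ 2 * B"
        using \<open>B \<ge> 0\<close> by (intro mult_right_mono) (cases n; auto simp: power2_eq_square algebra_simps)+
      also have "\<dots> \<le> real n ^ 2 * B * (sqrt 2 * sin \<theta>)"
        using mult_left_mono[OF sin_ge_sqrt2_div_2[OF 2], of "real n ^ 2 * B"] \<open>B \<ge> 0\<close> by simp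
      finally show ?thesis by (simp add: mult_ac)
    next
      case 3
      have "\<bar>r \<theta>\<bar> \<le> real n ^ 2 * B * (pi - \<theta>)" using lip[of \<theta> pi] \<theta> by (simp add: r_def)
      also have "\<dots> \<le> real n ^ 2 * B * (sqrt 2 * sin (pi - \<theta>))"
        using 3 \<theta> \<open>B \<ge> 0\<close> by (intro mult_left_mono sin_ge_div_sqrt2) auto
      finally show ?thesis by (simp add: mult_ac)
    qed
  qed
  then show ?thesis
    using \<open>sin \<theta> > 0\<close> by (simp add: r_def \<theta> abs_mult)
qed

text \<open>The mean value theorem yields a point strictly between \<open>x\<close> and
  \<open>y\<close>, so the interior estimate suffices although \<open>x\<close> and \<open>y\<close>
  may be endpoints.\<close>

lemma markov_lipschitz:
  fixes p :: "real poly"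
  assumes "degree p \<le> n" and B: "\<And>x. \<bar>x\<bar> \<le> 1 \<Longrightarrow> \<bar>poly p x\<bar> \<le> B"
    and "\<bar>x\<bar> \<le> 1" "\<bar>y\<bar> \<le> 1"
  shows "\<bar>poly p x - poly p y\<bar> \<le> sqrt 2 * real n ^ 2 * B * \<bar>x - y\<bar>"
  using assms(3,4)
proof (induction x y rule: linorder_wlog)
  case (le x y)
  show ?case
  proof (cases "x = y")
    case False
    with le have "x < y" by simp
    then obtain z where z: "x < z" "z < y" "poly p y - poly p x = (y - x) * poly (pderiv p) z"
      using poly_MVT by blast
    then have "\<bar>poly (pderiv p) z\<bar> \<le> sqrt 2 * real n ^ 2 * B"
      using le by (intro markov_inequality_interior[OF assms(1) B]) auto
    then have "\<bar>y - x\<bar> * \<bar>poly (pderiv p) z\<bar> \<le> \<bar>y - x\<bar> * (sqrt 2 * real n ^ 2 * B)"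
      by (intro mult_left_mono) auto
    then have "\<bar>poly p y - poly p x\<bar> \<le> sqrt 2 * real n ^ 2 * B * \<bar>y - x\<bar>"
      unfolding z(3) by (simp add: abs_mult mult_ac)
    then show ?thesis by (simp add: abs_minus_commute)
  qed simp
next
  case (sym x y)
  then show ?case by (simp add: abs_minus_commute)
qed

section \<open>Unisolvence of the Padua points\<close>

text \<open>The three-term recurrence of the Chebyshev polynomials; the induction carries two
  consecutive ones. The exact degree is recorded because the products of two of them are later told
  apart by degree.\<close>

lemma chebyshev_poly_exists:
  "\<exists>T::real poly. degree T = n \<and> (\<forall>t. poly T (cos t) = cos (real n * t))"
proof -
  have "\<exists>T U::real poly. degree T = n \<and> degree U = Suc n \<and>
      (\<forall>t. poly T (cos t) = cos (real n * t)) \<and> (\<forall>t. poly U (cos t) = cos (real (Suc n) * t))"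
  proof (induction n)
    case 0
    show ?case by (intro exI[of _ 1] exI[of _ "[:0, 1:]"]) auto
  next
    case (Suc n)
    then obtain T U :: "real poly" where IH: "degree T = n" "degree U = Suc n"
      "\<And>t. poly T (cos t) = cos (real n * t)" "\<And>t. poly U (cos t) = cos (real (Suc n) * t)"
      by blast
    define V where "V = pCons 0 (smult 2 U) - T"
    have "degree (pCons 0 (smult 2 U)) = Suc (Suc n)"
      using IH(2) by (auto simp: degree_pCons_eq_if)
    then have "degree V = Suc (Suc n)"
      unfolding V_def using IH(1) by (metis degree_add_eq_left degree_minus diff_conv_add_uminus lessI less_SucI)
    moreover have "poly V (cos t) = cos (real (Suc (Suc n)) * t)" for t
    proof -
      have "real (Suc (Suc n)) * t = real (Suc n) * t + t" "real n * t = real (Suc n) * t - t"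
        by (simp_all add: algebra_simps)
      then have "cos (real (Suc (Suc n)) * t) + cos (real n * t) = 2 * cos t * cos (real (Suc n) * t)"
        by (simp only: cos_add cos_diff) simp
      then show ?thesis unfolding V_def by (simp add: IH(3,4) del: of_nat_Suc)
    qed
    ultimately show ?case using IH by blast
  qed
  then show ?thesis by blast
qed

text \<open>Among the terms with nonzero coefficient, the leading term of the one of largest degree
  cannot cancel.\<close>

lemma coeffs_0_if_distinct_degrees:
  fixes q :: "'i \<Rightarrow> 'a::idom poly"
  assumes "finite I" and inj: "inj_on (\<lambda>k. degree (q k)) I"
    and nz: "\<And>k. k \<in> I \<Longrightarrow> q k \<noteq> 0"
    and sum0: "(\<Sum>k\<in>I. smult (c k) (q k)) = 0"
  shows "\<forall>k\<in>I. c k = 0"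
proof (rule ccontr)
  define J where "J = {k\<in>I. c k \<noteq> 0}"
  assume "\<not> ?thesis"
  then have "finite J" "J \<noteq> {}" using \<open>finite I\<close> by (auto simp: J_def)
  then obtain k0 where k0: "k0 \<in> J" "\<And>k. k \<in> J \<Longrightarrow> degree (q k) \<le> degree (q k0)"
    using obtains_MAX[of J "\<lambda>k. degree (q k)"] by (metis Max_ge finite_imageI imageI)
  have lower: "coeff (smult (c k) (q k)) (degree (q k0)) = 0" if "k \<in> I" "k \<noteq> k0" for k
  proof (cases "c k = 0")
    case False
    then have "k \<in> J" using that by (simp add: J_def)
    moreover have "degree (q k) \<noteq> degree (q k0)"
      using that k0(1) inj by (auto simp: inj_on_def J_def)
    ultimately show ?thesis using k0(2)[of k] by (simp add: coeff_eq_0)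
  qed simp
  have "coeff (\<Sum>k\<in>I. smult (c k) (q k)) (degree (q k0)) =
      (\<Sum>k\<in>I. coeff (smult (c k) (q k)) (degree (q k0)))"
    by (rule coeff_sum)
  also have "\<dots> = coeff (smult (c k0) (q k0)) (degree (q k0)) +
      (\<Sum>k\<in>I - {k0}. coeff (smult (c k) (q k)) (degree (q k0)))"
    using k0(1) \<open>finite I\<close> by (intro sum.remove) (auto simp: J_def)
  also have "(\<Sum>k\<in>I - {k0}. coeff (smult (c k) (q k)) (degree (q k0))) = 0"
    by (intro sum.neutral) (use lower in blast)
  finally have "c k0 * lead_coeff (q k0) = 0" using sum0 by simp
  then show False using k0(1) nz[of k0] by (auto simp: J_def)
qed

section \<open>Padua points as a chessboard half of a grid and as points on the generating
  curve\<close>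

lemma cos_multiple_eq_cos_bounded:
  fixes k n :: nat
  assumes "n > 0"
  shows "\<exists>a\<le>n. even (k + a) \<and> cos (real k * pi / real n) = cos (real a * pi / real n)"
proof -
  \<comment> \<open>Reduction modulo \<open>2 * n\<close> and reflection to \<open>2 * n - r\<close>
    keep the cosine and also the parity of the index, which decides whether a grid node is a Padua
    point.\<close>
  define r where "r = k mod (2 * n)"
  obtain d where k: "k = 2 * n * d + r"
    by (metis r_def mult_div_mod_eq)
  have "r < 2 * n" using assms by (simp add: r_def)
  have "real k * pi / real n = real r * pi / real n + 2 * real d * pi"
    using assms by (simp add: k field_simps)
  then have cos_eq: "cos (real k * pi / real n) = cos (real r * pi / real n)"
    by (simp only: cos_add cos_2npi sin_2npi mult_1_right mult_zero_right diff_zero)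
  have "even (k + r)" by (simp add: k)
  show ?thesis
  proof (cases "r \<le> n")
    case True
    then show ?thesis using cos_eq \<open>even (k + r)\<close> by blast
  next
    case False
    then have "real (2 * n - r) * pi / real n = 2 * pi - real r * pi / real n"
      using \<open>r < 2 * n\<close> assms by (simp add: of_nat_diff field_simps)
    then have "cos (real (2 * n - r) * pi / real n) = cos (real r * pi / real n)"
      by (simp add: cos_diff)
    moreover have "even (k + (2 * n - r))"
      using \<open>even (k + r)\<close> \<open>r < 2 * n\<close> by auto
    ultimately show ?thesis using cos_eq False
      by (intro exI[of _ "2 * n - r"]) auto
  qed
qed

lemma neg_cos_reflect:
  assumes "a \<le> n" "n > 0"
  shows "- cos (real (n - a) * pi / real n) = cos (real a * pi / real n)"
proof -
  have "real (n - a) * pi / real n = pi - real a * pi / real n"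
    using assms by (simp add: of_nat_diff field_simps)
  then show ?thesis by simp
qed

text \<open>A sign -1 reflects both indices, to \<open>m + 1 - j\<close> and \<open>m - i\<close>,
  whose sum \<open>2m + 1 - (i + j)\<close> is even when \<open>i + j\<close> is odd. Even
  \<open>i + j\<close> thus yields the nodes with \<open>a + b \<le> m\<close>, odd
  \<open>i + j\<close> those with \<open>a + b > m\<close>.\<close>

lemma padua_points_eq_grid:
  assumes "m > 0"
  shows "padua_points m =
    {(cos (real a * pi / real (m + 1)), cos (real b * pi / real m)) | a b.
       a \<le> m + 1 \<and> b \<le> m \<and> even (a + b)}" (is "_ = ?G")
proof (intro equalityI subsetI)
  fix z assume "z \<in> padua_points m"
  then obtain i j where z: "z = ((-1) ^ (i + j) * cos (pi * real j / real (m + 1)),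
       (-1) ^ (i + j) * cos (real i * pi / real m))" and "i + j \<le> m"
    by (auto simp: padua_points_def)
  show "z \<in> ?G"
  proof (cases "even (i + j)")
    case True
    then have "z = (cos (real j * pi / real (m + 1)), cos (real i * pi / real m))"
      by (simp add: z mult.commute)
    then show ?thesis using True \<open>i + j \<le> m\<close> by (force simp: add.commute)
  next
    case False
    have "- cos (real j * pi / real (m + 1)) = cos (real (m + 1 - j) * pi / real (m + 1))"
      using neg_cos_reflect[of j "m + 1"] \<open>i + j \<le> m\<close> by simp
    moreover have "- cos (real i * pi / real m) = cos (real (m - i) * pi / real m)"
      using neg_cos_reflect[of i m] assms \<open>i + j \<le> m\<close> by simp
    ultimately have "z = (cos (real (m + 1 - j) * pi / real (m + 1)), cos (real (m - i) * pi / real m))"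
      using False by (simp add: z mult.commute del: of_nat_Suc of_nat_add)
    moreover have "even (m + 1 - j + (m - i))" using False \<open>i + j \<le> m\<close> by presburger
    ultimately show ?thesis by fastforce
  qed
next
  fix z assume "z \<in> ?G"
  then obtain a b where z: "z = (cos (real a * pi / real (m + 1)), cos (real b * pi / real m))"
    and ab: "a \<le> m + 1" "b \<le> m" "even (a + b)" by blast
  show "z \<in> padua_points m"
  proof (cases "a + b \<le> m")
    case True
    have "z = ((-1) ^ (b + a) * cos (pi * real a / real (m + 1)),
       (-1) ^ (b + a) * cos (real b * pi / real m))"
      using ab(3) by (simp add: z mult.commute add.commute)
    then show ?thesis using True unfolding padua_points_def by (force simp: add.commute)
  next
    case False
    define i where "i = m - b"
    define j where "j = m + 1 - a"
    have "odd (i + j)" "i + j \<le> m" using False ab unfolding i_def j_def by presburger+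
    moreover have "- cos (real j * pi / real (m + 1)) = cos (real a * pi / real (m + 1))"
      using neg_cos_reflect[of a "m + 1"] ab unfolding j_def by simp
    moreover have "- cos (real i * pi / real m) = cos (real b * pi / real m)"
      using neg_cos_reflect[of b m] assms ab unfolding i_def by simp
    ultimately have "z = ((-1) ^ (i + j) * cos (pi * real j / real (m + 1)),
       (-1) ^ (i + j) * cos (real i * pi / real m))"
      by (simp add: z mult.commute del: of_nat_Suc of_nat_add)
    then show ?thesis using \<open>i + j \<le> m\<close> unfolding padua_points_def by blast
  qed
qed

text \<open>These are the points with parameter \<open>t = k pi / (m (m + 1))\<close> on the generating curve
  \<open>(cos (m t), cos ((m + 1) t))\<close>.\<close>

lemma padua_curve_point:
  assumes "m > 0"
  shows "(cos (real k * pi / real (m + 1)), cos (real k * pi / real m)) \<in> padua_points m"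
proof -
  obtain a where a: "a \<le> m + 1" "even (k + a)"
    "cos (real k * pi / real (m + 1)) = cos (real a * pi / real (m + 1))"
    using cos_multiple_eq_cos_bounded[of "m + 1" k] by auto
  obtain b where b: "b \<le> m" "even (k + b)"
    "cos (real k * pi / real m) = cos (real b * pi / real m)"
    using cos_multiple_eq_cos_bounded[of m k] assms by auto
  have "even (a + b)" using a(2) b(2) by presburger
  then show ?thesis
    unfolding padua_points_eq_grid[OF assms] a(3) b(3) using a(1) b(1) by blast
qed

abbreviation poly_indices :: "nat \<Rightarrow> (nat \<times> nat) set" where
  "poly_indices m \<equiv> {(i, j). i + j \<le> m}"

lemma finite_poly_indices: "finite (poly_indices m)"
  by (rule finite_subset[of _ "{..m} \<times> {..m}"]) auto

lemma card_poly_indices: "card (poly_indices m) = (m + 1) * (m + 2) div 2"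
proof -
  have "poly_indices m = (SIGMA i:{..m}. {..m - i})" by auto
  then have "card (poly_indices m) = (\<Sum>i\<le>m. Suc (m - i))" by simp
  also have "\<dots> = (\<Sum>i\<le>m. Suc i)"
    by (rule sum.reindex_bij_witness[of _ "\<lambda>i. m - i" "\<lambda>i. m - i"]) auto
  also have "\<dots> = (m + 1) * (m + 2) div 2" by (induction m) auto
  finally show ?thesis .
qed

lemma padua_points_as_image:
  "padua_points m = (\<lambda>(i, j). ((-1) ^ (i + j) * cos (pi * real j / real (m + 1)),
       (-1) ^ (i + j) * cos (real i * pi / real m))) ` poly_indices m"
  by (auto simp: padua_points_def image_def)

text \<open>Substituting the generating curve turns a bivariate polynomial into a polynomial in \<open>u = cos t\<close>
  of degree at most \<open>m (m + 1)\<close> with \<open>m (m + 1) + 1\<close> roots, and the monomials into polynomials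
  \<open>T\<^sub>m(u)\<^sup>i T\<^sub>m\<^sub>+\<^sub>1(u)\<^sup>j\<close> of pairwise different degrees.\<close>

lemma padua_points_coeffs_0:
  fixes c :: "nat \<times> nat \<Rightarrow> real"
  assumes "m > 0"
    and zero: "\<And>x y. (x, y) \<in> padua_points m \<Longrightarrow>
      (\<Sum>(i, j)\<in>poly_indices m. c (i, j) * x ^ i * y ^ j) = 0"
  shows "\<forall>k\<in>poly_indices m. c k = 0"
proof -
  define I where "I = poly_indices m"
  obtain S :: "real poly" where S: "degree S = m" "\<And>t. poly S (cos t) = cos (real m * t)"
    using chebyshev_poly_exists by blast
  obtain T :: "real poly" where T: "degree T = m + 1" "\<And>t. poly T (cos t) = cos (real (m + 1) * t)"
    using chebyshev_poly_exists by blast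
  have nz: "S \<noteq> 0" "T \<noteq> 0" using S T assms by auto
  define q where "q = (\<lambda>(i, j). S ^ i * T ^ j)"
  have degree_q: "degree (q (i, j)) = i * m + j * (m + 1)" for i j
    using nz S T by (simp add: q_def degree_mult_eq degree_power_eq)
  define P where "P = (\<Sum>k\<in>I. smult (c k) (q k))"
  define N where "N = m * (m + 1)"
  have "N > 0" using assms by (simp add: N_def)
  have "degree P \<le> N"
    unfolding P_def
  proof (intro degree_sum_le order.trans[OF degree_smult_le])
    show "finite I" unfolding I_def by (rule finite_poly_indices)
    fix k assume "k \<in> I"
    then obtain i j where "k = (i, j)" "i + j \<le> m" by (auto simp: I_def)
    then have "degree (q k) \<le> (i + j) * (m + 1)" by (simp add: degree_q algebra_simps)
    also have "\<dots> \<le> N" using \<open>i + j \<le> m\<close> unfolding N_def by (rule mult_right_mono) simp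
    finally show "degree (q k) \<le> N" .
  qed
  have root: "poly P (cos (real k * pi / real N)) = 0" for k
  proof -
    have cancel: "x * (z / (x * y)) = z / y" if "x \<noteq> 0" for x y z :: real
      using that by simp
    have "real m * (real k * pi / real N) = real k * pi / real (m + 1)"
      "real (m + 1) * (real k * pi / real N) = real k * pi / real m"
      using cancel[of "real m" "real (m + 1)"] cancel[of "real (m + 1)" "real m"] assms
      unfolding N_def of_nat_mult by (simp_all add: mult.commute)
    then have "poly S (cos (real k * pi / real N)) = cos (real k * pi / real (m + 1))"
      "poly T (cos (real k * pi / real N)) = cos (real k * pi / real m)"
      by (simp_all only: S(2) T(2))
    then show ?thesis
      using zero[OF padua_curve_point[OF assms(1), of k]]
      by (simp add: P_def poly_sum q_def case_prod_unfold I_def mult_ac del: of_nat_Suc of_nat_add)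
  qed
  have "P = 0"
  proof (rule ccontr)
    assume "P \<noteq> 0"
    have "inj_on (\<lambda>k. cos (real k * pi / real N)) {..N}"
    proof (intro inj_onI)
      fix k l assume kl: "k \<in> {..N}" "l \<in> {..N}"
        and eq: "cos (real k * pi / real N) = cos (real l * pi / real N)"
      have "0 \<le> real i * pi / real N \<and> real i * pi / real N \<le> pi" if "i \<in> {..N}" for i
        using that \<open>N > 0\<close> by (simp add: divide_le_eq)
      then have "real k * pi / real N = real l * pi / real N"
        using cos_inj_pi[OF _ _ _ _ eq] kl by blast
      then show "k = l" using \<open>N > 0\<close> by simp
    qed
    then have "card ((\<lambda>k. cos (real k * pi / real N)) ` {..N}) = Suc N" by (simp add: card_image)
    moreover have "card ((\<lambda>k. cos (real k * pi / real N)) ` {..N}) \<le> card {x. poly P x = 0}"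
      using root poly_roots_finite[OF \<open>P \<noteq> 0\<close>] by (intro card_mono) auto
    ultimately show False using card_poly_roots_bound[OF \<open>P \<noteq> 0\<close>] \<open>degree P \<le> N\<close> by simp
  qed
  have "inj_on (\<lambda>k. degree (q k)) I"
  proof (intro inj_onI)
    fix k k' assume "k \<in> I" "k' \<in> I" and eq: "degree (q k) = degree (q k')"
    then obtain i j i' j' where k: "k = (i, j)" "k' = (i', j')" "i + j \<le> m" "i' + j' \<le> m"
      by (auto simp: I_def)
    \<comment> \<open>\<open>i + j\<close> and \<open>m - i\<close> are the quotient and the remainder of \<open>degree + m\<close> modulo \<open>m + 1\<close>.\<close>
    have decomp: "degree (q (i, j)) + m = (i + j) * (m + 1) + (m - i)" if "i + j \<le> m" for i j
      using that by (simp add: degree_q algebra_simps)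
    have "(i + j) * (m + 1) + (m - i) = (i' + j') * (m + 1) + (m - i')"
      using k eq decomp by metis
    then have "((i + j) * (m + 1) + (m - i)) div (m + 1) = ((i' + j') * (m + 1) + (m - i')) div (m + 1)"
      "((i + j) * (m + 1) + (m - i)) mod (m + 1) = ((i' + j') * (m + 1) + (m - i')) mod (m + 1)"
      by simp_all
    moreover have "((i + j) * (m + 1) + (m - i)) div (m + 1) = i + j"
      "((i + j) * (m + 1) + (m - i)) mod (m + 1) = m - i" for i j
      by (subst div_mult_self3, simp, simp) (subst mod_mult_self3, simp)
    ultimately have "i + j = i' + j'" "m - i = m - i'" by metis+
    then show "k = k'" using k by auto
  qed
  moreover have "finite I" unfolding I_def by (rule finite_poly_indices)
  moreover have "q k \<noteq> 0" for k using nz by (cases k) (simp add: q_def)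
  ultimately show ?thesis
    using coeffs_0_if_distinct_degrees[of I q c] \<open>P = 0\<close> unfolding P_def I_def by blast
qed

section \<open>Triangles and separation\<close>

text \<open>A segment as a set determines its endpoints up to order, hence its length
  \<open>len\<close>; the lengths are then an image of the finitely many faces. Finiteness gives the
  \<open>Max\<close> in \<open>max_edge_length\<close> its meaning.\<close>

lemma finite_edge_lengths:
  fixes ts :: "(real \<times> real) set list"
  assumes "\<forall>t\<in>set ts. polytope t"
  shows "finite {dist a b | a b. \<exists>t\<in>set ts. closed_segment a b edge_of t}"
proof -
  define len where "len = (\<lambda>F::(real \<times> real) set. SOME d. \<exists>a b. F = closed_segment a b \<and> d = dist a b)"
  have len: "len (closed_segment a b) = dist a b" for a b
  proof -
    have "\<exists>a' b'. closed_segment a b = closed_segment a' b' \<and> len (closed_segment a b) = dist a' b'"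
      unfolding len_def by (rule someI_ex) blast
    then show ?thesis by (auto simp: closed_segment_eq doubleton_eq_iff dist_commute)
  qed
  have "finite (len ` (\<Union>t\<in>set ts. {F. F face_of t}))"
    using assms by (auto intro: finite_polytope_faces)
  then show ?thesis
    by (rule rev_finite_subset) (auto simp: edge_of_def image_iff len[symmetric])
qed

text \<open>Distances in a simplex are dominated by those between vertices, and any two different
  vertices span an edge.\<close>

lemma dist_le_max_edge_length:
  assumes "\<forall>t\<in>set ts. 2 simplex t" "t \<in> set ts" "x \<in> t" "y \<in> t"
  shows "dist x y \<le> max_edge_length ts"
proof -
  define E where "E = {dist a b | a b. \<exists>t\<in>set ts. closed_segment a b edge_of t}"
  have "finite E"
    unfolding E_def using assms(1) by (intro finite_edge_lengths) (auto intro: simplex_imp_polytope)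
  have "2 simplex t" using assms(1,2) by blast
  then obtain C where C: "\<not> affine_dependent C" "card C = 3" "t = convex hull C"
    unfolding simplex_def by auto
  have edge: "dist u v \<in> E" if "u \<in> C" "v \<in> C" "u \<noteq> v" for u v
  proof -
    have "closed_segment u v face_of t"
      unfolding C(3) face_of_convex_hull_affine_independent[OF C(1)] segment_convex_hull
      by (rule exI[of _ "{u, v}"]) (use that in simp)
    moreover have "aff_dim (closed_segment u v) = 1"
      using that by (simp add: segment_convex_hull aff_dim_convex_hull)
    ultimately show ?thesis unfolding E_def edge_of_def using assms(2) by blast
  qed
  obtain u v where uv: "u \<in> C" "v \<in> C" "dist x y \<le> dist u v"
    using simplex_extremal_le_exists[OF aff_independent_finite[OF C(1)]] assms(3,4)
    unfolding C(3) dist_norm by blast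
  have "dist u v \<le> Max E"
  proof (cases "u = v")
    \<comment> \<open>The dominating vertices may coincide; a genuine edge then shows
      \<open>0 \<le> Max E\<close>.\<close>
    case True
    have "\<exists>w\<in>C. w \<noteq> u"
    proof (rule ccontr)
      assume "\<not> ?thesis"
      then have "C \<subseteq> {u}" by blast
      then have "card C \<le> card {u}" by (intro card_mono) auto
      then show False using C(2) by simp
    qed
    then obtain w where "w \<in> C" "w \<noteq> u" by blast
    then have "dist u w \<le> Max E" using edge uv \<open>finite E\<close> by (intro Max_ge) auto
    then have "0 \<le> Max E" by (rule order.trans[OF zero_le_dist])
    then show ?thesis using True by simp
  next
    case False
    then show ?thesis using edge uv \<open>finite E\<close> by (intro Max_ge) auto
  qed
  then show ?thesis using uv(3) by (simp add: max_edge_length_def E_def)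
qed

section \<open>Mean values over triangles\<close>

lemma measure_2_simplex_pos:
  fixes t :: "(real \<times> real) set"
  assumes "2 simplex t"
  shows "measure lborel t > 0"
proof -
  obtain C where C: "\<not> affine_dependent C" "card C = 3" "t = convex hull C"
    using assms unfolding simplex_def by auto
  then have "interior t \<noteq> {}"
    using interior_convex_hull_eq_empty[of C] by simp
  then obtain c e where ce: "e > 0" "ball c e \<subseteq> t"
    using mem_interior by blast
  have "0 < measure lborel (ball c e)" using ce(1) by (rule content_ball_pos)
  also have "\<dots> \<le> measure lborel t"
    using ce(2) compact_simplex[OF assms] by (intro measure_mono_fmeasurable fmeasurable_compact) auto
  finally show ?thesis .
qed

lemma set_integrable_compact:
  fixes f :: "'a::euclidean_space \<Rightarrow> real"
  assumes "compact t" "continuous_on t f"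
  shows "set_integrable lborel t f"
  unfolding set_integrable_def using assms by (rule borel_integrable_compact)

lemma mean_value_sum:
  assumes "compact t" "finite I" "\<And>k. k \<in> I \<Longrightarrow> continuous_on t (f k)"
  shows "mean_value t (\<lambda>z. \<Sum>k\<in>I. c k * f k z) = (\<Sum>k\<in>I. c k * mean_value t (f k))"
proof -
  have "(LINT z:t|lborel. (\<Sum>k\<in>I. c k * f k z)) = (\<Sum>k\<in>I. c k * (LINT z:t|lborel. f k z))"
    using assms(2,3)
  proof (induction I rule: finite_induct)
    case empty
    then show ?case by simp
  next
    case (insert k I)
    have "set_integrable lborel t (\<lambda>z. c k * f k z)"
      "set_integrable lborel t (\<lambda>z. \<Sum>k\<in>I. c k * f k z)"
      using insert.prems by (auto intro!: set_integrable_compact assms(1) continuous_intros)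
    then show ?case using insert by (simp add: set_integral_add(2))
  qed
  then show ?thesis by (simp add: mean_value_def sum_distrib_left mult_ac)
qed

text \<open>Integrate \<open>v - d \<le> f z \<le> v + d\<close> over \<open>t\<close>. When the
  mean value is 0, this bounds \<open>v\<close>, the value at a Padua point.\<close>

lemma mean_value_near:
  assumes "compact t" "continuous_on t f" "measure lborel t > 0"
    and near: "\<And>z. z \<in> t \<Longrightarrow> \<bar>f z - v\<bar> \<le> d"
  shows "\<bar>mean_value t f - v\<bar> \<le> d"
proof -
  have t: "t \<in> sets lborel" "emeasure lborel t \<noteq> \<infinity>"
    using fmeasurable_compact[OF assms(1)] by (auto simp: fmeasurable_def)
  have const: "(LINT z:t|lborel. a) = measure lborel t * a" for a :: real
    using set_integral_const[OF t, of a] by simp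
  have int: "set_integrable lborel t f" "set_integrable lborel t (\<lambda>_. a)" for a :: real
    using assms by (auto intro!: set_integrable_compact)
  have "measure lborel t * (v - d) \<le> (LINT z:t|lborel. f z)"
    unfolding const[symmetric] by (intro set_integral_mono int) (use near in \<open>force simp: abs_le_iff\<close>)
  moreover have "(LINT z:t|lborel. f z) \<le> measure lborel t * (v + d)"
    unfolding const[symmetric] by (intro set_integral_mono int) (use near in \<open>force simp: abs_le_iff\<close>)
  ultimately have "v - d \<le> mean_value t f" "mean_value t f \<le> v + d"
    using assms(3) by (simp_all add: mean_value_def pos_le_divide_eq pos_divide_le_eq mult.commute)
  then show ?thesis by linarith
qed

section \<open>Distances between Padua points\<close>

lemma sqrt2_mult_le_sqrt_sum_squares:
  fixes x y :: real
  assumes "\<theta> \<le> \<bar>x\<bar>" "\<theta> \<le> \<bar>y\<bar>" "0 \<le> \<theta>"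
  shows "sqrt 2 * \<theta> \<le> sqrt (x\<^sup>2 + y\<^sup>2)"
proof -
  have "\<theta>\<^sup>2 \<le> x\<^sup>2" "\<theta>\<^sup>2 \<le> y\<^sup>2" using assms by (simp_all add: abs_le_square_iff[symmetric])
  then have "sqrt (2 * \<theta>\<^sup>2) \<le> sqrt (x\<^sup>2 + y\<^sup>2)" by (intro real_sqrt_le_mono) simp
  then show ?thesis using assms(3) by (simp add: real_sqrt_mult)
qed

text \<open>Cosine nodes are densest at the ends, where \<open>d\<close> steps from index 0 cover
  the left-hand side. Product formulas turn the two sides into \<open>2 * sin v * sin v\<close> and
  \<open>2 * sin u * sin w\<close>, with \<open>v \<le> w \<le> pi / 2\<close> and
  \<open>v \<le> u \<le> pi - v\<close>.\<close>

lemma cos_nodes_separated: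
  fixes a b n d :: nat
  assumes "a + d \<le> b" "b \<le> n" "n > 0"
  shows "1 - cos (real d * pi / real n) \<le> cos (real a * pi / real n) - cos (real b * pi / real n)"
proof -
  define s where "s = pi / (2 * real n)"
  define u where "u = (real b + real a) * s"
  define w where "w = (real b - real a) * s"
  define v where "v = real d * s"
  have s: "0 < s" "real n * s = pi / 2" "pi / real n = 2 * s"
    using assms(3) by (simp_all add: s_def)
  have half: "real k * pi / real n = 2 * (real k * s)" for k
    using s(3) by (metis mult.left_commute times_divide_eq_right)
  have le: "real a + real d \<le> real b" "real b \<le> real n" using assms by linarith+
  have "cos (real a * pi / real n) - cos (real b * pi / real n) = 2 * sin u * sin w"
  proof -
    have "(2 * (real a * s) + 2 * (real b * s)) / 2 = u" "(2 * (real b * s) - 2 * (real a * s)) / 2 = w"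
      by (simp_all add: u_def w_def field_simps)
    then show ?thesis unfolding half cos_diff_cos by simp
  qed
  moreover have "1 - cos (real d * pi / real n) = 2 * sin v * sin v"
    unfolding half using cos_diff_cos[of 0 "2 * v"] by (simp add: v_def)
  moreover have "(real b + real a + real d) * s \<le> (2 * real n) * s"
    using le s(1) by (intro mult_right_mono) auto
  then have "u \<le> pi - v"
    using s(2) unfolding u_def v_def by (simp add: algebra_simps)
  have "w \<le> real n * s" "v \<le> w" "v \<le> u" "0 \<le> v"
    using le s(1) unfolding u_def v_def w_def by (auto intro!: mult_right_mono)
  then have "w \<le> pi / 2" "v \<le> pi / 2" unfolding s(2) by auto
  have "sin v \<le> sin u" "sin v \<le> sin w" "0 \<le> sin v"
  proof -
    show "sin v \<le> sin w" using \<open>0 \<le> v\<close> \<open>v \<le> w\<close> \<open>w \<le> pi / 2\<close>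
      by (intro sin_monotone_2pi_le) auto
    show "0 \<le> sin v" using \<open>0 \<le> v\<close> \<open>v \<le> pi / 2\<close> by (intro sin_ge_zero) auto
    show "sin v \<le> sin u"
    proof (cases "u \<le> pi / 2")
      case True
      then show ?thesis using \<open>0 \<le> v\<close> \<open>v \<le> u\<close> by (intro sin_monotone_2pi_le) auto
    next
      case False
      then have "sin v \<le> sin (pi - u)" using \<open>0 \<le> v\<close> \<open>u \<le> pi - v\<close>
        by (intro sin_monotone_2pi_le) auto
      then show ?thesis by simp
    qed
  qed
  then have "sin v * sin v \<le> sin u * sin w" by (intro mult_mono) auto
  ultimately show ?thesis by simp
qed

lemma cos_nodes_separated_abs:
  fixes a b n d :: nat
  assumes "d \<le> nat \<bar>int a - int b\<bar>" "a \<le> n" "b \<le> n" "n > 0"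
  shows "1 - cos (real d * pi / real n) \<le> \<bar>cos (real a * pi / real n) - cos (real b * pi / real n)\<bar>"
  using cos_nodes_separated[of a d b n] cos_nodes_separated[of b d a n] assms by linarith

text \<open>Two steps in one coordinate make up for the factor \<open>sqrt 2\<close> that a move in
  both coordinates gives.\<close>

lemma one_minus_cos_double:
  assumes "n \<ge> 2"
  shows "sqrt 2 * (1 - cos (pi / real n)) \<le> 1 - cos (2 * pi / real n)"
proof -
  define c where "c = cos (pi / real n)"
  have "pi / real n \<le> pi / 2" using assms by (intro divide_left_mono) auto
  then have "0 \<le> c" unfolding c_def by (intro cos_ge_zero) (auto intro: order.trans[of _ 0])
  have "c \<le> 1" by (simp add: c_def)
  have "sqrt 2 \<le> 2" by (rule real_le_lsqrt) auto
  also have "2 \<le> 2 * (1 + c)" using \<open>0 \<le> c\<close> by simp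
  finally have "sqrt 2 \<le> 2 * (1 + c)" .
  then have "sqrt 2 * (1 - c) \<le> 2 * (1 + c) * (1 - c)" using \<open>c \<le> 1\<close> by (intro mult_right_mono) auto
  also have "\<dots> = 1 - cos (2 * (pi / real n))"
    unfolding cos_double_cos c_def by (simp add: algebra_simps power2_eq_square)
  finally show ?thesis by (simp add: c_def)
qed

lemma two_le_diff_if_same_parity:
  fixes a b :: nat
  assumes "a \<noteq> b" "even (a + b)"
  shows "2 \<le> nat \<bar>int a - int b\<bar>"
proof -
  have "a + 2 \<le> b \<or> b + 2 \<le> a" using assms by presburger
  then show ?thesis by linarith
qed

text \<open>By the parity condition two different points differ in both coordinates, each by at
  least the smallest gap \<open>1 - cos (pi / (m + 1))\<close>, or in one coordinate by at least two
  index steps.\<close>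

lemma padua_points_separated:
  assumes "m \<ge> 2" "z \<in> padua_points m" "w \<in> padua_points m" "z \<noteq> w"
  shows "sqrt 2 * (1 - cos (pi / real (m + 1))) \<le> dist z w"
proof -
  have "m > 0" using assms by simp
  note grid = padua_points_eq_grid[OF this]
  define X where "X = (\<lambda>a. cos (real a * pi / real (m + 1)))"
  define Y where "Y = (\<lambda>b. cos (real b * pi / real m))"
  obtain a b where z: "z = (X a, Y b)" "a \<le> m + 1" "b \<le> m" "even (a + b)"
    using assms(2) unfolding grid X_def Y_def by blast
  obtain a' b' where w: "w = (X a', Y b')" "a' \<le> m + 1" "b' \<le> m" "even (a' + b')"
    using assms(3) unfolding grid X_def Y_def by blast
  have dist: "dist z w = sqrt ((X a - X a')\<^sup>2 + (Y b - Y b')\<^sup>2)"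
    by (simp add: z w dist_prod_def dist_real_def)
  \<comment> \<open>The second coordinate has the coarser grid, so its gaps are at least those for
    \<open>m + 1\<close>. Monotonicity of the cosine needs \<open>k * pi / m \<le> pi\<close>, which
    holds for two steps since \<open>m \<ge> 2\<close>.\<close>
  have le: "cos (k * pi / real m) \<le> cos (k * pi / real (m + 1))" if "0 \<le> k" "k \<le> 2" for k
  proof (intro cos_monotone_0_pi_le)
    have "k * pi \<le> real m * pi" using that assms by (intro mult_right_mono) auto
    then show "k * pi / real m \<le> pi" using \<open>m > 0\<close> by (simp add: divide_le_eq mult.commute)
    show "k * pi / real (m + 1) \<le> k * pi / real m"
      using that \<open>m > 0\<close> by (intro divide_left_mono) auto
  qed (use that in auto)
  have X: "1 - cos (real d * pi / real (m + 1)) \<le> \<bar>X a - X a'\<bar>" if "d \<le> nat \<bar>int a - int a'\<bar>" for d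
    unfolding X_def using that z w by (intro cos_nodes_separated_abs) auto
  have Y: "1 - cos (real d * pi / real (m + 1)) \<le> \<bar>Y b - Y b'\<bar>"
    if "d \<le> nat \<bar>int b - int b'\<bar>" "d \<le> 2" for d
    using cos_nodes_separated_abs[OF that(1), of m] le[of "real d"] that z w \<open>m > 0\<close>
    unfolding Y_def by auto
  note double = one_minus_cos_double[of "m + 1"]
  consider "a = a'" "b \<noteq> b'" | "a \<noteq> a'" "b = b'" | "a \<noteq> a'" "b \<noteq> b'"
    using assms(4) z w by auto
  then show ?thesis
  proof cases
    case 1
    then have "2 \<le> nat \<bar>int b - int b'\<bar>" using z(4) w(4) by (intro two_le_diff_if_same_parity) auto
    then have "sqrt 2 * (1 - cos (pi / real (m + 1))) \<le> \<bar>Y b - Y b'\<bar>" using Y[of 2] double assms by simp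
    then show ?thesis using 1 by (simp add: dist)
  next
    case 2
    then have "2 \<le> nat \<bar>int a - int a'\<bar>" using z(4) w(4) by (intro two_le_diff_if_same_parity) auto
    then have "sqrt 2 * (1 - cos (pi / real (m + 1))) \<le> \<bar>X a - X a'\<bar>" using X[of 2] double assms by simp
    then show ?thesis using 2 by (simp add: dist)
  next
    case 3
    then have "1 \<le> nat \<bar>int a - int a'\<bar>" "1 \<le> nat \<bar>int b - int b'\<bar>" by auto
    then show ?thesis
      using X[of 1] Y[of 1] unfolding dist by (intro sqrt2_mult_le_sqrt_sum_squares) auto
  qed
qed

section \<open>Interpolation and histopolation\<close>

text \<open>A single index for both exponents turns coefficients into functions on
  \<open>poly_indices m\<close>, the form of the unknowns in the linear systems.\<close>

definition bivariate_monom :: "nat \<times> nat \<Rightarrow> real \<times> real \<Rightarrow> real" where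
  "bivariate_monom k z = fst z ^ fst k * snd z ^ snd k"

lemma continuous_on_bivariate_monom: "continuous_on S (bivariate_monom k)"
  unfolding bivariate_monom_def by (intro continuous_intros)

lemma bivariate_polys_iff:
  "p \<in> bivariate_polys m \<longleftrightarrow>
     (\<exists>c. p = (\<lambda>z. \<Sum>k\<in>poly_indices m. c k * bivariate_monom k z))"
proof
  assume "p \<in> bivariate_polys m"
  then obtain c where "p = (\<lambda>(x, y). \<Sum>(i, j)\<in>poly_indices m. c i j * x ^ i * y ^ j)"
    by (auto simp: bivariate_polys_def)
  then show "\<exists>c. p = (\<lambda>z. \<Sum>k\<in>poly_indices m. c k * bivariate_monom k z)"
    by (intro exI[of _ "\<lambda>(i, j). c i j"])
      (simp add: fun_eq_iff bivariate_monom_def case_prod_unfold mult.assoc)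
next
  assume "\<exists>c. p = (\<lambda>z. \<Sum>k\<in>poly_indices m. c k * bivariate_monom k z)"
  then obtain c where "p = (\<lambda>z. \<Sum>k\<in>poly_indices m. c k * bivariate_monom k z)" by blast
  then have "p = (\<lambda>(x, y). \<Sum>(i, j)\<in>poly_indices m. c (i, j) * x ^ i * y ^ j)"
    by (simp add: fun_eq_iff bivariate_monom_def case_prod_unfold mult.assoc)
  then show "p \<in> bivariate_polys m" 
    unfolding bivariate_polys_def by (intro CollectI exI[of _ "\<lambda>i j. c (i, j)"])
qed

lemma bivariate_polysI: "(\<lambda>z. \<Sum>k\<in>poly_indices m. c k * bivariate_monom k z) \<in> bivariate_polys m"
  unfolding bivariate_polys_iff by blast

lemma continuous_on_bivariate_polys:
  assumes "p \<in> bivariate_polys m"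
  shows "continuous_on S p"
  using assms unfolding bivariate_polys_iff
  by (auto intro!: continuous_intros continuous_on_bivariate_monom)

lemma bivariate_polys_diff:
  assumes "p \<in> bivariate_polys m" "q \<in> bivariate_polys m"
  shows "(\<lambda>z. p z - q z) \<in> bivariate_polys m"
proof -
  obtain c d where "p = (\<lambda>z. \<Sum>k\<in>poly_indices m. c k * bivariate_monom k z)"
    "q = (\<lambda>z. \<Sum>k\<in>poly_indices m. d k * bivariate_monom k z)"
    using assms unfolding bivariate_polys_iff by blast
  then have "(\<lambda>z. p z - q z) = (\<lambda>z. \<Sum>k\<in>poly_indices m. (c k - d k) * bivariate_monom k z)"
    by (simp add: sum_subtractf left_diff_distrib)
  then show ?thesis by (simp only: bivariate_polysI)
qed

lemma bivariate_polys_sum: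
  assumes "\<And>x. x \<in> X \<Longrightarrow> f x \<in> bivariate_polys m"
  shows "(\<lambda>z. \<Sum>x\<in>X. a x * f x z) \<in> bivariate_polys m"
proof -
  have "\<forall>x\<in>X. \<exists>c. f x = (\<lambda>z. \<Sum>k\<in>poly_indices m. c k * bivariate_monom k z)"
    using assms unfolding bivariate_polys_iff by blast
  then obtain c where c: "\<And>x. x \<in> X \<Longrightarrow> f x = (\<lambda>z. \<Sum>k\<in>poly_indices m. c x k * bivariate_monom k z)"
    by metis
  have "(\<Sum>x\<in>X. a x * f x z) = (\<Sum>k\<in>poly_indices m. (\<Sum>x\<in>X. a x * c x k) * bivariate_monom k z)" for z
  proof -
    have "(\<Sum>x\<in>X. a x * f x z) = (\<Sum>x\<in>X. \<Sum>k\<in>poly_indices m. a x * c x k * bivariate_monom k z)"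
      by (intro sum.cong refl) (simp add: c sum_distrib_left mult.assoc)
    also have "\<dots> = (\<Sum>k\<in>poly_indices m. \<Sum>x\<in>X. a x * c x k * bivariate_monom k z)"
      by (rule sum.swap)
    finally show ?thesis by (simp add: sum_distrib_right)
  qed
  then show ?thesis by (simp only: bivariate_polysI)
qed

lemma padua_points_vanish_coeffs:
  assumes "m > 0"
    and "\<And>z. z \<in> padua_points m \<Longrightarrow> (\<Sum>k\<in>poly_indices m. c k * bivariate_monom k z) = 0"
  shows "\<forall>k\<in>poly_indices m. c k = 0"
proof (rule padua_points_coeffs_0[OF assms(1)])
  fix x y :: real assume "(x, y) \<in> padua_points m"
  from assms(2)[OF this] show "(\<Sum>(i, j)\<in>poly_indices m. c (i, j) * x ^ i * y ^ j) = 0"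
    by (simp add: bivariate_monom_def case_prod_unfold mult.assoc)
qed

lemma bivariate_polys_eq_if_eq_on_padua_points:
  assumes "m > 0" "p \<in> bivariate_polys m" "q \<in> bivariate_polys m"
    and eq: "\<And>z. z \<in> padua_points m \<Longrightarrow> p z = q z"
  shows "p = q"
proof -
  obtain c where c: "(\<lambda>z. p z - q z) = (\<lambda>z. \<Sum>k\<in>poly_indices m. c k * bivariate_monom k z)"
    using bivariate_polys_diff[OF assms(2,3)] unfolding bivariate_polys_iff by blast
  have c0: "\<forall>k\<in>poly_indices m. c k = 0"
  proof (rule padua_points_vanish_coeffs[OF assms(1)])
    fix z assume "z \<in> padua_points m"
    then show "(\<Sum>k\<in>poly_indices m. c k * bivariate_monom k z) = 0"
      using eq[of z] fun_cong[OF c, of z] by simp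
  qed
  have "p z - q z = 0" for z
    unfolding fun_cong[OF c] by (intro sum.neutral ballI) (metis c0 mult_zero_left)
  then show ?thesis by (simp add: fun_eq_iff)
qed

lemma finite_padua_points: "finite (padua_points m)"
  unfolding padua_points_as_image by (intro finite_imageI finite_poly_indices)

text \<open>Coincidences in the parametrisation are excluded by linear algebra: with fewer points
  than coefficients, nonzero coefficients would give a polynomial vanishing at all points.\<close>

lemma card_padua_points:
  assumes "m > 0"
  shows "card (padua_points m) = card (poly_indices m)"
proof (rule antisym)
  show "card (padua_points m) \<le> card (poly_indices m)"
    unfolding padua_points_as_image by (intro card_image_le finite_poly_indices)
  show "card (poly_indices m) \<le> card (padua_points m)"
  proof (rule ccontr)
    assume "\<not> ?thesis"
    then have "card (padua_points m) < card (poly_indices m)" by simp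
    from homogeneous_system_nontrivial_solution[OF finite_padua_points finite_poly_indices this,
        of "\<lambda>z k. bivariate_monom k z"]
    obtain c where "\<exists>k\<in>poly_indices m. c k \<noteq> 0"
      "\<And>z. z \<in> padua_points m \<Longrightarrow> (\<Sum>k\<in>poly_indices m. c k * bivariate_monom k z) = 0"
      by (auto simp: mult.commute)
    then show False using padua_points_vanish_coeffs[OF assms, of c] by blast
  qed
qed

text \<open>The description in \<open>lagrange_poly\<close> denotes: existence is a square system
  with trivial kernel, uniqueness is unisolvence of the Padua points.\<close>

lemma lagrange_poly_padua:
  assumes "m > 0"
  shows "lagrange_poly m (padua_points m) x \<in> bivariate_polys m"
    and "y \<in> padua_points m \<Longrightarrow> lagrange_poly m (padua_points m) x y = (if y = x then 1 else 0)"
proof -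
  have "\<exists>c. \<forall>z\<in>padua_points m. (\<Sum>k\<in>poly_indices m. bivariate_monom k z * c k) = (if z = x then 1 else 0)"
    using padua_points_vanish_coeffs[OF assms] card_padua_points[OF assms]
    by (intro square_system_solvable finite_padua_points finite_poly_indices) (auto simp: mult.commute)
  then obtain c where c: "\<forall>z\<in>padua_points m. (\<Sum>k\<in>poly_indices m. bivariate_monom k z * c k) = (if z = x then 1 else 0)"
    by blast
  define l where "l = (\<lambda>z. \<Sum>k\<in>poly_indices m. c k * bivariate_monom k z)"
  have l: "l \<in> bivariate_polys m" "\<forall>y\<in>padua_points m. l y = (if y = x then 1 else 0)"
    using c unfolding l_def by (auto simp: bivariate_polysI mult.commute)
  then have "\<exists>!l. l \<in> bivariate_polys m \<and> (\<forall>y\<in>padua_points m. l y = (if y = x then 1 else 0))"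
    by (intro ex1I[of _ l]) (auto intro!: bivariate_polys_eq_if_eq_on_padua_points[OF assms])
  from theI'[OF this]
  show "lagrange_poly m (padua_points m) x \<in> bivariate_polys m"
    and "y \<in> padua_points m \<Longrightarrow> lagrange_poly m (padua_points m) x y = (if y = x then 1 else 0)"
    unfolding lagrange_poly_def by blast+
qed

section \<open>Bounds from the Lebesgue constant and from Markov's inequality\<close>

lemma bivariate_poly_le_lebesgue_constant:
  assumes "m > 0" "p \<in> bivariate_polys m" "\<xi> \<in> \<Omega>" "compact \<Omega>"
    and A: "\<And>x. x \<in> padua_points m \<Longrightarrow> \<bar>p x\<bar> \<le> A" "0 \<le> A"
  shows "\<bar>p \<xi>\<bar> \<le> A * lebesgue_constant m (padua_points m) \<Omega>"
proof -
  let ?X = "padua_points m"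
  let ?l = "lagrange_poly m ?X"
  have "p = (\<lambda>z. \<Sum>x\<in>?X. p x * ?l x z)"
  proof (rule bivariate_polys_eq_if_eq_on_padua_points[OF assms(1,2)])
    show "(\<lambda>z. \<Sum>x\<in>?X. p x * ?l x z) \<in> bivariate_polys m"
      by (intro bivariate_polys_sum lagrange_poly_padua assms)
    show "p z = (\<Sum>x\<in>?X. p x * ?l x z)" if "z \<in> ?X" for z
      using that by (simp add: lagrange_poly_padua assms finite_padua_points sum.delta' if_distrib cong: if_cong)
  qed
  then have "\<bar>p \<xi>\<bar> = \<bar>\<Sum>x\<in>?X. p x * ?l x \<xi>\<bar>" by metis
  also have "\<dots> \<le> (\<Sum>x\<in>?X. \<bar>p x * ?l x \<xi>\<bar>)" by (rule sum_abs)
  also have "\<dots> \<le> (\<Sum>x\<in>?X. A * \<bar>?l x \<xi>\<bar>)"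
    by (intro sum_mono) (simp add: abs_mult mult_right_mono A)
  also have "\<dots> = A * (\<Sum>x\<in>?X. \<bar>?l x \<xi>\<bar>)" by (simp add: sum_distrib_left)
  also have "(\<Sum>x\<in>?X. \<bar>?l x \<xi>\<bar>) \<le> lebesgue_constant m ?X \<Omega>"
    unfolding lebesgue_constant_def
  proof (rule cSUP_upper[OF assms(3)])
    \<comment> \<open>A real supremum dominates its members only if the set is bounded above; here
      this comes from compactness.\<close>
    have "continuous_on \<Omega> (\<lambda>\<xi>. \<Sum>x\<in>?X. \<bar>?l x \<xi>\<bar>)"
      by (intro continuous_intros continuous_on_bivariate_polys[OF lagrange_poly_padua(1)[OF assms(1)]])
    then show "bdd_above ((\<lambda>\<xi>. \<Sum>x\<in>?X. \<bar>?l x \<xi>\<bar>) ` \<Omega>)"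
      using assms(4) by (intro bounded_imp_bdd_above compact_imp_bounded compact_continuous_image)
  qed
  finally show ?thesis using A(2) by (simp add: mult_left_mono)
qed

lemma bivariate_poly_slice_fst:
  assumes "p \<in> bivariate_polys m"
  shows "\<exists>q. degree q \<le> m \<and> (\<forall>x. poly q x = p (x, y))"
proof -
  obtain c where c: "p = (\<lambda>z. \<Sum>k\<in>poly_indices m. c k * bivariate_monom k z)"
    using assms unfolding bivariate_polys_iff by blast
  have "degree (\<Sum>k\<in>poly_indices m. monom (c k * y ^ snd k) (fst k)) \<le> m"
    by (intro degree_sum_le finite_poly_indices) (auto intro: order.trans[OF degree_monom_le])
  then show ?thesis
    by (intro exI conjI allI, assumption) (simp add: c poly_sum poly_monom bivariate_monom_def mult_ac)
qed

lemma bivariate_poly_slice_snd: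
  assumes "p \<in> bivariate_polys m"
  shows "\<exists>q. degree q \<le> m \<and> (\<forall>y. poly q y = p (x, y))"
proof -
  obtain c where c: "p = (\<lambda>z. \<Sum>k\<in>poly_indices m. c k * bivariate_monom k z)"
    using assms unfolding bivariate_polys_iff by blast
  have "degree (\<Sum>k\<in>poly_indices m. monom (c k * x ^ fst k) (snd k)) \<le> m"
    by (intro degree_sum_le finite_poly_indices) (auto intro: order.trans[OF degree_monom_le])
  then show ?thesis
    by (intro exI conjI allI, assumption) (simp add: c poly_sum poly_monom bivariate_monom_def mult_ac)
qed

text \<open>Go from \<open>z\<close> to \<open>w\<close> through the corner \<open>(x', y)\<close>,
  which lies in the square: on each leg \<open>p\<close> is a univariate polynomial of degree at
  most \<open>m\<close>, bounded by \<open>B\<close> on the whole slice.\<close>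

lemma bivariate_poly_lipschitz:
  assumes "p \<in> bivariate_polys m" "z \<in> unit_square" "w \<in> unit_square"
    and B: "\<And>\<xi>. \<xi> \<in> unit_square \<Longrightarrow> \<bar>p \<xi>\<bar> \<le> B"
  shows "\<bar>p z - p w\<bar> \<le> 2 * real m ^ 2 * B * dist z w"
proof -
  obtain x y x' y' where zw: "z = (x, y)" "w = (x', y')" by (cases z, cases w)
  have square: "(u, v) \<in> unit_square" if "\<bar>u\<bar> \<le> 1" "\<bar>v\<bar> \<le> 1" for u v :: real
    using that by (auto simp: abs_le_iff)
  have bounds: "\<bar>x\<bar> \<le> 1" "\<bar>y\<bar> \<le> 1" "\<bar>x'\<bar> \<le> 1" "\<bar>y'\<bar> \<le> 1"
    using assms(2,3) by (auto simp: zw abs_le_iff)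
  have "0 \<le> B" using B[of "(0, 0)"] by auto
  obtain q where q: "degree q \<le> m" "\<And>x. poly q x = p (x, y)"
    using bivariate_poly_slice_fst[OF assms(1)] by metis
  have "\<bar>p (x, y) - p (x', y)\<bar> \<le> sqrt 2 * real m ^ 2 * B * \<bar>x - x'\<bar>"
    unfolding q(2)[symmetric] using bounds
    by (intro markov_lipschitz q(1)) (unfold q(2), intro B square)
  moreover obtain r where r: "degree r \<le> m" "\<And>y. poly r y = p (x', y)"
    using bivariate_poly_slice_snd[OF assms(1)] by metis
  have "\<bar>p (x', y) - p (x', y')\<bar> \<le> sqrt 2 * real m ^ 2 * B * \<bar>y - y'\<bar>"
    unfolding r(2)[symmetric] using bounds
    by (intro markov_lipschitz r(1)) (unfold r(2), intro B square)
  ultimately have "\<bar>p z - p w\<bar> \<le> sqrt 2 * real m ^ 2 * B * (\<bar>x - x'\<bar> + \<bar>y - y'\<bar>)"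
    unfolding zw ring_distribs by linarith
  also have "\<bar>x - x'\<bar> + \<bar>y - y'\<bar> \<le> sqrt 2 * dist z w"
  proof -
    have "(\<bar>x - x'\<bar> + \<bar>y - y'\<bar>)\<^sup>2 \<le> 2 * ((x - x')\<^sup>2 + (y - y')\<^sup>2)"
      using sum_squares_bound[of "\<bar>x - x'\<bar>" "\<bar>y - y'\<bar>"] by (simp add: power2_sum)
    then have "\<bar>x - x'\<bar> + \<bar>y - y'\<bar> \<le> sqrt (2 * ((x - x')\<^sup>2 + (y - y')\<^sup>2))"
      by (rule real_le_rsqrt)
    then show ?thesis by (simp add: zw dist_prod_def dist_real_def flip: real_sqrt_mult)
  qed
  finally have "\<bar>p z - p w\<bar> \<le> sqrt 2 * real m ^ 2 * B * (sqrt 2 * dist z w)"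
    using \<open>0 \<le> B\<close> by (simp add: mult_left_mono)
  also have "\<dots> = (sqrt 2 * sqrt 2) * real m ^ 2 * B * dist z w" by (simp only: mult_ac)
  finally show ?thesis by simp
qed

section \<open>The histopolation problem\<close>

lemma first_triangle_in:
  assumes "x \<in> \<Union> (set ts)"
  shows "first_triangle ts x \<in> set ts" "x \<in> first_triangle ts x"
proof -
  obtain t where t: "List.find (\<lambda>t. x \<in> t) ts = Some t"
    using assms by (cases "List.find (\<lambda>t. x \<in> t) ts") (auto simp: find_None_iff)
  then show "first_triangle ts x \<in> set ts" "x \<in> first_triangle ts x"
    using t[unfolded find_Some_iff] unfolding first_triangle_def t option.sel by auto
qed

lemma padua_points_subset_square: "padua_points m \<subseteq> unit_square"
  by (auto simp: padua_points_def minus_one_power_iff)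

theorem proposition2:
  fixes m :: nat and K \<alpha> :: real and ts :: "(real \<times> real) set list"
  assumes "m \<ge> 2"
    and "K > 0"
    and "\<forall>k \<ge> 2. lebesgue_constant k (padua_points k) unit_square \<le> K * (ln (real k)) ^ 2"
    and "triangulates ts unit_square"
    and "0 < \<alpha>" and "\<alpha> < 1"
    and "max_edge_length ts <
           min (\<alpha> / (2 * K * (real m * ln (real m)) ^ 2))
               (sqrt 2 * (1 - cos (pi / real (m + 1))))"
  shows "unisolvent m (padua_triangles m ts) \<and>
         histopolation_well_defined m (padua_triangles m ts) unit_square"
proof -
  let ?X = "padua_points m" and ?T = "padua_triangles m ts" and ?I = "poly_indices m"
  define h where "h = max_edge_length ts"
  have "m > 0" using \<open>m \<ge> 2\<close> by simp
  have simplex: "\<forall>t\<in>set ts. 2 simplex t" and cover: "unit_square = \<Union> (set ts)"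
    using assms(4) by (auto simp: triangulates_def)
  have triangle: "first_triangle ts x \<in> set ts" "x \<in> first_triangle ts x" if "x \<in> ?X" for x
    using that padua_points_subset_square[of m] cover by (auto intro!: first_triangle_in)
  have diam: "dist x y \<le> h" if "t \<in> set ts" "x \<in> t" "y \<in> t" for t x y
    unfolding h_def using simplex that by (rule dist_le_max_edge_length)
  \<comment> \<open>Some triangle contains a Padua point, whose distance 0 to itself gives
    \<open>0 \<le> h\<close>; this sign is used when estimates are multiplied by
    \<open>h\<close>.\<close>
  have "(0, 0) \<in> ?I" by simp
  then have "?X \<noteq> {}" unfolding padua_points_as_image by blast
  then have "0 \<le> h" using triangle diam by (metis dist_self ex_in_conv)
  have inj: "inj_on (first_triangle ts) ?X"
  proof (intro inj_onI, rule ccontr)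
    fix x y assume xy: "x \<in> ?X" "y \<in> ?X" "first_triangle ts x = first_triangle ts y" "x \<noteq> y"
    then have "dist x y \<le> h" using diam[of "first_triangle ts x" x y] triangle by metis
    moreover have "h < dist x y"
      using padua_points_separated[OF \<open>m \<ge> 2\<close> xy(1,2,4)] assms(7) by (simp add: h_def)
    ultimately show False by simp
  qed
  have T: "finite ?T" "card ?T = card ?I"
    using inj card_padua_points[OF \<open>m > 0\<close>]
    by (auto simp: padua_triangles_def finite_padua_points card_image)
  have T_sub: "?T \<subseteq> set ts" using triangle by (auto simp: padua_triangles_def)
  have unique: "p = (\<lambda>_. 0)" if p: "p \<in> bivariate_polys m" and zero: "\<forall>t\<in>?T. mean_value t p = 0" for p
  proof -
    have square: "compact unit_square" "unit_square \<noteq> {}" by (auto intro: compact_Times)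
    have "continuous_on unit_square (\<lambda>z. \<bar>p z\<bar>)"
      by (intro continuous_intros continuous_on_bivariate_polys[OF p])
    \<comment> \<open>The maximum is attained, so the Lebesgue estimate at the single point
      \<open>\<xi>\<close> bounds \<open>B\<close> by a multiple of itself.\<close>
    from continuous_attains_sup[OF square this]
    obtain \<xi> where \<xi>: "\<xi> \<in> unit_square" "\<And>z. z \<in> unit_square \<Longrightarrow> \<bar>p z\<bar> \<le> \<bar>p \<xi>\<bar>"
      by blast
    define B where "B = \<bar>p \<xi>\<bar>"
    have "\<bar>p x\<bar> \<le> 2 * real m ^ 2 * B * h" if "x \<in> ?X" for x
    proof -
      define t where "t = first_triangle ts x"
      have t: "t \<in> set ts" "x \<in> t" "t \<in> ?T"
        using triangle[OF that] that by (auto simp: t_def padua_triangles_def)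
      then have "2 simplex t" "t \<subseteq> unit_square" using simplex unfolding cover by blast+
      have "\<bar>mean_value t p - p x\<bar> \<le> 2 * real m ^ 2 * B * h"
      proof (rule mean_value_near)
        show "compact t" by (rule compact_simplex[OF \<open>2 simplex t\<close>])
        show "measure lborel t > 0" by (rule measure_2_simplex_pos[OF \<open>2 simplex t\<close>])
        show "continuous_on t p" by (rule continuous_on_bivariate_polys[OF p])
        fix z assume "z \<in> t"
        have "\<bar>p z - p x\<bar> \<le> 2 * real m ^ 2 * B * dist z x"
        proof (rule bivariate_poly_lipschitz[OF p])
          show "z \<in> unit_square" "x \<in> unit_square"
            using \<open>z \<in> t\<close> t(2) \<open>t \<subseteq> unit_square\<close> by blast+
        qed (unfold B_def, rule \<xi>(2))
        also have "\<dots> \<le> 2 * real m ^ 2 * B * h"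
          using diam[OF t(1) \<open>z \<in> t\<close> t(2)] by (intro mult_left_mono) (simp_all add: B_def)
        finally show "\<bar>p z - p x\<bar> \<le> 2 * real m ^ 2 * B * h" .
      qed
      then show ?thesis using zero t(3) by simp
    qed
    then have "B \<le> 2 * real m ^ 2 * B * h * lebesgue_constant m ?X unit_square"
      using bivariate_poly_le_lebesgue_constant[OF \<open>m > 0\<close> p \<xi>(1) square(1)] \<open>0 \<le> h\<close>
      unfolding B_def by simp
    also have "\<dots> \<le> 2 * real m ^ 2 * B * h * (K * (ln (real m)) ^ 2)"
      using assms(1,3) \<open>0 \<le> h\<close> by (intro mult_left_mono) (auto simp: B_def)
    also have "\<dots> = B * (h * (2 * K * (real m * ln (real m)) ^ 2))"
      by (simp add: power_mult_distrib mult_ac)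
    \<comment> \<open>\<open>m \<ge> 2\<close> makes \<open>ln m\<close> positive, so the bound on
      \<open>h\<close> can be multiplied by its denominator.\<close>
    also have "h * (2 * K * (real m * ln (real m)) ^ 2) \<le> \<alpha>"
      using assms(1,2,7) by (simp add: h_def pos_less_divide_eq)
    finally have "B \<le> B * \<alpha>" by (simp add: B_def mult_left_mono)
    then have "B * (1 - \<alpha>) \<le> 0" by (simp add: algebra_simps)
    moreover have "B \<ge> 0" by (simp add: B_def)
    ultimately have "B = 0" using \<open>\<alpha> < 1\<close> by (simp add: mult_le_0_iff)
    \<comment> \<open>\<open>B = 0\<close> gives zeros on the square only, whereas \<open>p\<close>
      is a function on the plane; unisolvence of the Padua points closes this gap.\<close>
    then have "p z = 0" if "z \<in> ?X" for z
      using \<xi>(2) that padua_points_subset_square[of m] by (force simp: B_def)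
    moreover have "(\<lambda>_. 0) \<in> bivariate_polys m" using bivariate_polysI[of "\<lambda>_. 0" m] by simp
    ultimately show ?thesis using bivariate_polys_eq_if_eq_on_padua_points[OF \<open>m > 0\<close> p] by blast
  qed
  have mean_sum: "mean_value t (\<lambda>z. \<Sum>k\<in>?I. c k * bivariate_monom k z) =
      (\<Sum>k\<in>?I. mean_value t (bivariate_monom k) * c k)" if "t \<in> ?T" for t c
    using that T_sub simplex
    by (subst mean_value_sum) (auto simp: mult.commute intro: compact_simplex finite_poly_indices continuous_on_bivariate_monom)
  have "unisolvent m ?T"
    unfolding unisolvent_def using T unique card_poly_indices[of m] by auto
  moreover have "\<exists>!p. is_histopolant m ?T f p" for f
  proof -
    have "\<exists>c. \<forall>t\<in>?T. (\<Sum>k\<in>?I. mean_value t (bivariate_monom k) * c k) = mean_value t f"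
    proof (intro square_system_solvable T finite_poly_indices)
      fix c assume "\<forall>t\<in>?T. (\<Sum>k\<in>?I. mean_value t (bivariate_monom k) * c k) = 0"
      then have "(\<lambda>z. \<Sum>k\<in>?I. c k * bivariate_monom k z) = (\<lambda>_. 0)"
        by (intro unique bivariate_polysI) (simp add: mean_sum)
      \<comment> \<open>A polynomial that is the zero function vanishes in particular at the Padua
        points, which forces its coefficients to be 0.\<close>
      then show "\<forall>k\<in>?I. c k = 0"
        by (intro padua_points_vanish_coeffs[OF \<open>m > 0\<close>]) metis
    qed
    then obtain c where "\<forall>t\<in>?T. (\<Sum>k\<in>?I. mean_value t (bivariate_monom k) * c k) = mean_value t f"
      by blast
    then have c: "is_histopolant m ?T f (\<lambda>z. \<Sum>k\<in>?I. c k * bivariate_monom k z)"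
      by (simp add: is_histopolant_def bivariate_polysI mean_sum)
    moreover have "p = q" if p: "is_histopolant m ?T f p" and q: "is_histopolant m ?T f q" for p q
    proof -
      have pq: "p \<in> bivariate_polys m" "q \<in> bivariate_polys m"
        using p q by (auto simp: is_histopolant_def)
      have "mean_value t (\<lambda>z. p z - q z) = 0" if "t \<in> ?T" for t
      proof -
        have "compact t" using that T_sub simplex by (auto intro: compact_simplex)
        then have "(LINT z:t|lborel. p z - q z) = (LINT z:t|lborel. p z) - (LINT z:t|lborel. q z)"
          by (intro set_integral_diff set_integrable_compact continuous_on_bivariate_polys[OF pq(1)]
              continuous_on_bivariate_polys[OF pq(2)])
        then have "mean_value t (\<lambda>z. p z - q z) = mean_value t p - mean_value t q"
          by (simp add: mean_value_def right_diff_distrib)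
        then show ?thesis using p q that by (simp add: is_histopolant_def)
      qed
      then have "(\<lambda>z. p z - q z) = (\<lambda>_. 0)"
        by (intro unique bivariate_polys_diff pq) simp
      then show ?thesis by (simp add: fun_eq_iff)
    qed
    ultimately show ?thesis by blast
  qed
  ultimately show ?thesis by (simp add: histopolation_well_defined_def)
qed

end
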